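(* A rotation surface $f:\mathbb{R}^2\supseteq D^2\to S^2\times\mathbb{R}$ with $$f(r,\theta)=(\sin k(r),\ \cos k(r)\cos\theta,\ \cos k(r)\sin\theta,\ h(r))$$ and $\Delta k=0$ is biharmonic if and only if it is minimal or an open subset of the vertical cylinder $S^1(\frac{1}{\sqrt2})\times\mathbb{R}\subset S^2\times\mathbb{R}$.
   Context: $S^2\subset\mathbb{R}^3$ is the unit sphere, $S^2\times\mathbb{R}$ carries the product metric, and $k,h$ are smooth functions of $r$. $\Delta$ is the Laplacian (trace of the Hessian) on the surface with respect to the metric induced by $f$, and $k$ is regarded as a function on the surface. A surface is biharmonic if its defining isometric immersion is a biharmonic map (critical point of the bienergy $\frac12\int|\tau|^2$, $\tau$ the tension field), and minimal if its mean curvature vanishes identically. $S^1(\frac1{\sqrt2})\subset S^2$ is a circle of radius $\frac1{\sqrt2}$. *)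

theory Defs
  imports "HOL-Analysis.Analysis"
begin

section \<open>Smooth maps on open sets\<close>

text \<open>On open sets of a Euclidean space, \<open>higher_differentiable_on S n f\<close> is \<open>C^n\<close>: the
  directional derivatives in all constant directions exist and are again \<open>C^(n-1)\<close>.\<close>

primrec higher_differentiable_on ::
    "'a::real_normed_vector set \<Rightarrow> nat \<Rightarrow> ('a \<Rightarrow> 'b::real_normed_vector) \<Rightarrow> bool" where
  "higher_differentiable_on S 0 f \<longleftrightarrow> continuous_on S f"
| "higher_differentiable_on S (Suc n) f \<longleftrightarrow>
     (\<forall>x\<in>S. f differentiable (at x)) \<and>
     (\<forall>v. higher_differentiable_on S n (\<lambda>x. frechet_derivative f (at x) v))"

definition smooth_on ::
    "'a::real_normed_vector set \<Rightarrow> ('a \<Rightarrow> 'b::real_normed_vector) \<Rightarrow> bool" where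
  "smooth_on S f \<longleftrightarrow> (\<forall>n. higher_differentiable_on S n f)"


section \<open>Riemannian metrics on planar domains\<close>

text \<open>The parameter domain lies in \<^typ>\<open>real^2\<close>, with \<open>p $ 1 = r\<close> and \<open>p $ 2 = \<theta>\<close>. A metric is
  given by its matrix of coefficients in these coordinates.\<close>

type_synonym planar_metric = "real^2 \<Rightarrow> real^2^2"

definition partial_deriv :: "2 \<Rightarrow> (real^2 \<Rightarrow> 'b::real_normed_vector) \<Rightarrow> real^2 \<Rightarrow> 'b" where
  "partial_deriv i u p = frechet_derivative u (at p) (axis i 1)"

definition inverse_metric :: "planar_metric \<Rightarrow> planar_metric" where
  "inverse_metric g p = matrix_inv (g p)"

definition christoffel :: "planar_metric \<Rightarrow> 2 \<Rightarrow> 2 \<Rightarrow> 2 \<Rightarrow> real^2 \<Rightarrow> real" where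
  "christoffel g l i j p =
     1/2 * (\<Sum>m\<in>UNIV. inverse_metric g p $ l $ m *
       (partial_deriv i (\<lambda>q. g q $ j $ m) p + partial_deriv j (\<lambda>q. g q $ i $ m) p
        - partial_deriv m (\<lambda>q. g q $ i $ j) p))"

definition metric_trace :: "planar_metric \<Rightarrow> (2 \<Rightarrow> 2 \<Rightarrow> 'b) \<Rightarrow> real^2 \<Rightarrow> 'b::real_vector" where
  "metric_trace g B p = (\<Sum>i\<in>UNIV. \<Sum>j\<in>UNIV. (inverse_metric g p $ i $ j) *\<^sub>R B i j)"

definition hessian :: "planar_metric \<Rightarrow> (real^2 \<Rightarrow> real) \<Rightarrow> real^2 \<Rightarrow> 2 \<Rightarrow> 2 \<Rightarrow> real" where
  "hessian g u p i j =
     partial_deriv i (partial_deriv j u) p - (\<Sum>l\<in>UNIV. christoffel g l i j p * partial_deriv l u p)"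

definition laplacian :: "planar_metric \<Rightarrow> (real^2 \<Rightarrow> real) \<Rightarrow> real^2 \<Rightarrow> real" where
  "laplacian g u p = metric_trace g (hessian g u p) p"


section \<open>The product \<open>S^2 \<times> \<real>\<close>\<close>

text \<open>\<open>S^2 \<times> \<real>\<close> is a submanifold of \<^typ>\<open>(real^3) \<times> real\<close>, whose inner product is the product one;
  the submanifold metric is therefore the product metric, and its Levi-Civita connection is the
  ambient derivative followed by the orthogonal projection onto the tangent space.\<close>

type_synonym ambient = "(real^3) \<times> real"

definition S2xR :: "ambient set" where
  "S2xR = sphere 0 1 \<times> UNIV"

definition tangent_space :: "ambient \<Rightarrow> ambient set" where
  "tangent_space y = {w. fst w \<bullet> fst y = 0}"

definition tangent_proj :: "ambient \<Rightarrow> ambient \<Rightarrow> ambient" where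
  "tangent_proj y w = (fst w - (fst w \<bullet> fst y) *\<^sub>R fst y, snd w)"

text \<open>\<open>cov_deriv \<phi> i j\<close> is the covariant derivative, along \<open>\<phi>\<close>, of \<open>\<partial>\<^sub>j \<phi>\<close> in the direction
  \<open>\<partial>\<^sub>i\<close>.\<close>

definition cov_deriv :: "(real^2 \<Rightarrow> ambient) \<Rightarrow> real^2 \<Rightarrow> 2 \<Rightarrow> 2 \<Rightarrow> ambient" where
  "cov_deriv \<phi> p i j = tangent_proj (\<phi> p) (partial_deriv i (partial_deriv j \<phi>) p)"


section \<open>Biharmonic maps into \<open>S^2 \<times> \<real>\<close>\<close>

text \<open>The coefficients of \<open>\<nabla>d\<phi>\<close>.\<close>

definition nabla_d :: "planar_metric \<Rightarrow> (real^2 \<Rightarrow> ambient) \<Rightarrow> real^2 \<Rightarrow> 2 \<Rightarrow> 2 \<Rightarrow> ambient" where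
  "nabla_d g \<phi> p i j =
     cov_deriv \<phi> p i j - (\<Sum>l\<in>UNIV. christoffel g l i j p *\<^sub>R partial_deriv l \<phi> p)"

definition tension_field :: "planar_metric \<Rightarrow> (real^2 \<Rightarrow> ambient) \<Rightarrow> real^2 \<Rightarrow> ambient" where
  "tension_field g \<phi> p = metric_trace g (nabla_d g \<phi> p) p"

definition bienergy :: "planar_metric \<Rightarrow> (real^2) set \<Rightarrow> (real^2 \<Rightarrow> ambient) \<Rightarrow> real" where
  "bienergy g K \<phi> =
     1/2 * (LINT p:K|lborel. (norm (tension_field g \<phi> p))\<^sup>2 * sqrt (det (g p)))"

definition variation_of ::
    "(real^2) set \<Rightarrow> (real^2) set \<Rightarrow> (real^2 \<Rightarrow> ambient) \<Rightarrow> real \<Rightarrow> (real \<Rightarrow> real^2 \<Rightarrow> ambient) \<Rightarrow> bool" where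
  "variation_of D K \<phi> \<epsilon> F \<longleftrightarrow>
     smooth_on ({-\<epsilon><..<\<epsilon>} \<times> D) (\<lambda>(t, p). F t p) \<and>
     (\<forall>t\<in>{-\<epsilon><..<\<epsilon>}. \<forall>p\<in>D. F t p \<in> S2xR) \<and>
     (\<forall>p\<in>D. F 0 p = \<phi> p) \<and>
     (\<forall>t\<in>{-\<epsilon><..<\<epsilon>}. \<forall>p\<in>D - K. F t p = \<phi> p)"

text \<open>The metric \<open>g\<close> on the domain stays fixed while the map varies.\<close>

definition biharmonic_map :: "planar_metric \<Rightarrow> (real^2) set \<Rightarrow> (real^2 \<Rightarrow> ambient) \<Rightarrow> bool" where
  "biharmonic_map g D \<phi> \<longleftrightarrow>
     (\<forall>K \<epsilon> F. compact K \<and> K \<subseteq> D \<and> \<epsilon> > 0 \<and> variation_of D K \<phi> \<epsilon> F \<longrightarrow>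
        ((\<lambda>t. bienergy g K (F t)) has_real_derivative 0) (at 0))"


section \<open>Surfaces in \<open>S^2 \<times> \<real>\<close>\<close>

definition immersed_surface :: "(real^2) set \<Rightarrow> (real^2 \<Rightarrow> ambient) \<Rightarrow> bool" where
  "immersed_surface D f \<longleftrightarrow>
     smooth_on D f \<and> f ` D \<subseteq> S2xR \<and> (\<forall>p\<in>D. inj (frechet_derivative f (at p)))"

definition induced_metric :: "(real^2 \<Rightarrow> ambient) \<Rightarrow> planar_metric" where
  "induced_metric f p = (\<chi> i j. partial_deriv i f p \<bullet> partial_deriv j f p)"

definition biharmonic_surface :: "(real^2) set \<Rightarrow> (real^2 \<Rightarrow> ambient) \<Rightarrow> bool" where
  "biharmonic_surface D f \<longleftrightarrow> biharmonic_map (induced_metric f) D f"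

definition unit_normal :: "(real^2 \<Rightarrow> ambient) \<Rightarrow> real^2 \<Rightarrow> ambient \<Rightarrow> bool" where
  "unit_normal f p \<xi> \<longleftrightarrow>
     norm \<xi> = 1 \<and> \<xi> \<in> tangent_space (f p) \<and> (\<forall>i. \<xi> \<bullet> partial_deriv i f p = 0)"

definition second_fundamental_form ::
    "(real^2 \<Rightarrow> ambient) \<Rightarrow> ambient \<Rightarrow> real^2 \<Rightarrow> 2 \<Rightarrow> 2 \<Rightarrow> real" where
  "second_fundamental_form f \<xi> p i j = cov_deriv f p i j \<bullet> \<xi>"

definition mean_curvature :: "(real^2 \<Rightarrow> ambient) \<Rightarrow> ambient \<Rightarrow> real^2 \<Rightarrow> real" where
  "mean_curvature f \<xi> p =
     1/2 * metric_trace (induced_metric f) (second_fundamental_form f \<xi> p) p"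

text \<open>The two unit normals at a point give opposite mean curvatures, so no choice of orientation is
  needed.\<close>

definition minimal_surface :: "(real^2) set \<Rightarrow> (real^2 \<Rightarrow> ambient) \<Rightarrow> bool" where
  "minimal_surface D f \<longleftrightarrow> (\<forall>p\<in>D. \<forall>\<xi>. unit_normal f p \<xi> \<longrightarrow> mean_curvature f \<xi> p = 0)"


section \<open>Rotation surfaces and vertical cylinders\<close>

definition rotation_surface :: "(real \<Rightarrow> real) \<Rightarrow> (real \<Rightarrow> real) \<Rightarrow> real^2 \<Rightarrow> ambient" where
  "rotation_surface k h p =
     (let r = p $ 1; \<theta> = p $ 2
      in (vector [sin (k r), cos (k r) * cos \<theta>, cos (k r) * sin \<theta>], h r))"

text \<open>The circle of radius \<open>\<rho>\<close> about \<open>c\<close> in the plane through \<open>c\<close> with normal \<open>n\<close>.\<close>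

definition circle3 :: "real^3 \<Rightarrow> real^3 \<Rightarrow> real \<Rightarrow> (real^3) set" where
  "circle3 c n \<rho> = {x. dist x c = \<rho> \<and> n \<bullet> (x - c) = 0}"

definition open_part_of_vertical_cylinder ::
    "real \<Rightarrow> (real^2) set \<Rightarrow> (real^2 \<Rightarrow> ambient) \<Rightarrow> bool" where
  "open_part_of_vertical_cylinder \<rho> D f \<longleftrightarrow>
     (\<exists>c n. n \<noteq> 0 \<and> circle3 c n \<rho> \<subseteq> sphere 0 1 \<and>
        openin (top_of_set (circle3 c n \<rho> \<times> UNIV)) (f ` D))"

end

theory Submission
  imports Defs
begin

text \<open>Write \<open>X\<close> for the \<open>S\<^sup>2\<close>-component of the surface, \<open>N\<close> for the unit tangent of the meridian of \<open>S\<^sup>2\<close> through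
\<open>X\<close> and \<open>E dr\<^sup>2 + G d\<theta>\<^sup>2\<close> for the induced metric, so \<open>G = cos\<^sup>2 k\<close>. Two facts drive the proof. The condition
\<open>\<Delta>k = 0\<close> says that the flux \<open>sqrt (G/E) k'\<close> is a constant \<open>c\<close> (\<open>flux_constant\<close>), and under it the
tension field is \<open>(tan k N, \<Delta>h)\<close> (\<open>tension_rotation_surface\<close>).

For a compactly supported variation with field \<open>V\<close>, differentiating the bienergy under the integral
and moving the Laplacian from the sphere component of \<open>V\<close> to \<open>tan k N\<close> gives the first variation
\<open>\<integral> (\<rho> \<langle>V, N\<rangle> + \<Delta>h \<Delta>V\<^sub>\<real>) dA\<close> with \<open>\<rho> = tan k (2 (k'\<^sup>2/E) (1 + tan\<^sup>2 k) + 1 - tan\<^sup>2 k)\<close>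
(\<open>first_variation\<close>), where \<open>V\<^sub>\<real>\<close> is the component of \<open>V\<close> in the line factor. Variations that
slide the surface along the meridians by a bump function \<open>\<psi>\<close> have \<open>V = (\<psi> N, 0)\<close>, so a biharmonic
surface satisfies \<open>\<rho> = 0\<close>. Since the flux is constant, \<open>k'\<^sup>2/E = c\<^sup>2 (1 + tan\<^sup>2 k)\<close>, and \<open>\<rho>\<close> is a
nonzero polynomial in \<open>tan k\<close> with constant coefficients. If \<open>c\<close> were nonzero, \<open>tan k\<close> would be
injective and take infinitely many values, all of them roots. Hence \<open>k\<close> is constant, and
\<open>\<rho> = 0\<close> leaves \<open>tan k = 0\<close> or \<open>tan\<^sup>2 k = 1\<close> (\<open>\<rho>_zero_imp_constant\<close>).

Conversely, if \<open>k\<close> is constant with one of these values, then \<open>\<rho>\<close> vanishes, and so does \<open>\<Delta>h\<close>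
because the tension field is normal to the surface; thus every first variation is zero. It remains
to recognise the two cases: \<open>tan k = 0\<close> is minimality (\<open>minimal_iff\<close>), and \<open>tan\<^sup>2 k = 1\<close> means
\<open>cos\<^sup>2 k = 1/2\<close>, which is the cylinder over a circle of radius \<open>1 / sqrt 2\<close>.\<close>

section \<open>Smooth maps and mixed derivatives\<close>

abbreviation dir_deriv ::
    "'a::real_normed_vector \<Rightarrow> ('a \<Rightarrow> 'b::real_normed_vector) \<Rightarrow> 'a \<Rightarrow> 'b" where
  "dir_deriv v f \<equiv> \<lambda>x. frechet_derivative f (at x) v"

lemma smooth_on_differentiable: "smooth_on S f \<Longrightarrow> x \<in> S \<Longrightarrow> f differentiable (at x)"
  unfolding smooth_on_def by (metis higher_differentiable_on.simps(2))

lemma smooth_on_continuous: "smooth_on S f \<Longrightarrow> continuous_on S f"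
  unfolding smooth_on_def by (metis higher_differentiable_on.simps(1))

lemma smooth_on_dir_deriv: "smooth_on S f \<Longrightarrow> smooth_on S (dir_deriv v f)"
  unfolding smooth_on_def by (metis higher_differentiable_on.simps(2))

lemma smooth_on_has_derivative:
  "smooth_on S f \<Longrightarrow> x \<in> S \<Longrightarrow> (f has_derivative frechet_derivative f (at x)) (at x)"
  using smooth_on_differentiable frechet_derivative_works by blast

lemma has_vector_derivative_along_line:
  assumes "(f has_derivative f') (at (x + t *\<^sub>R v))"
  shows "((\<lambda>s. f (x + s *\<^sub>R v)) has_vector_derivative f' v) (at t)"
proof -
  have "((\<lambda>s. x + s *\<^sub>R v) has_derivative (\<lambda>s. s *\<^sub>R v)) (at t)"
    by (auto intro!: derivative_eq_intros)
  from has_derivative_compose[OF this, of f f'] assms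
  have "((\<lambda>s. f (x + s *\<^sub>R v)) has_derivative (\<lambda>s. f' (s *\<^sub>R v))) (at t)" by simp
  moreover have "f' (s *\<^sub>R v) = s *\<^sub>R f' v" for s
    using has_derivative_linear[OF assms] by (simp add: linear_cmul)
  ultimately show ?thesis by (simp add: has_vector_derivative_def)
qed

text \<open>At a fixed scale, the second difference of \<open>f\<close> along the parallelogram spanned by \<open>s v\<close> and
  \<open>s w\<close> is a value of \<open>s\<^sup>2 \<partial>\<^sub>w \<partial>\<^sub>v f\<close> by two applications of the mean value theorem.
  The second difference is symmetric in \<open>v\<close> and \<open>w\<close>, which forces the mixed derivatives to agree.\<close>

lemma second_difference_mean_value:
  fixes f :: "'a::real_normed_vector \<Rightarrow> real"
  assumes s: "0 < s"
    and f: "\<And>a c. 0 \<le> a \<Longrightarrow> a \<le> s \<Longrightarrow> 0 \<le> c \<Longrightarrow> c \<le> s \<Longrightarrow>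
      f differentiable (at (x + a *\<^sub>R v + c *\<^sub>R w))"
    and fv: "\<And>a c. 0 \<le> a \<Longrightarrow> a \<le> s \<Longrightarrow> 0 \<le> c \<Longrightarrow> c \<le> s \<Longrightarrow>
      dir_deriv v f differentiable (at (x + a *\<^sub>R v + c *\<^sub>R w))"
  shows "\<exists>a c. 0 < a \<and> a < s \<and> 0 < c \<and> c < s \<and>
    f (x + s *\<^sub>R v + s *\<^sub>R w) - f (x + s *\<^sub>R v) - f (x + s *\<^sub>R w) + f x =
      s\<^sup>2 * dir_deriv w (dir_deriv v f) (x + a *\<^sub>R v + c *\<^sub>R w)"
proof -
  have line_v: "((\<lambda>a. f (x + a *\<^sub>R v + c *\<^sub>R w)) has_real_derivative
      dir_deriv v f (x + a *\<^sub>R v + c *\<^sub>R w)) (at a)"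
    if "0 \<le> a" "a \<le> s" "0 \<le> c" "c \<le> s" for a c
    using has_vector_derivative_along_line[of f _ "x + c *\<^sub>R w" a v]
      f[OF that, unfolded frechet_derivative_works]
    by (simp add: has_real_derivative_iff_has_vector_derivative algebra_simps)
  have line_w: "((\<lambda>c. dir_deriv v f (x + a *\<^sub>R v + c *\<^sub>R w)) has_real_derivative
      dir_deriv w (dir_deriv v f) (x + a *\<^sub>R v + c *\<^sub>R w)) (at c)"
    if "0 \<le> a" "a \<le> s" "0 \<le> c" "c \<le> s" for a c
    using has_vector_derivative_along_line[of "dir_deriv v f" _ "x + a *\<^sub>R v" c w]
      fv[OF that, unfolded frechet_derivative_works]
    by (simp add: has_real_derivative_iff_has_vector_derivative algebra_simps)
  define g where "g a = f (x + a *\<^sub>R v + s *\<^sub>R w) - f (x + a *\<^sub>R v)" for a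
  have "(g has_real_derivative
      dir_deriv v f (x + a *\<^sub>R v + s *\<^sub>R w) - dir_deriv v f (x + a *\<^sub>R v)) (at a)"
    if "0 \<le> a" "a \<le> s" for a
    unfolding g_def using s line_v[OF that, of s] line_v[OF that, of 0]
    by (intro DERIV_diff) auto
  from MVT2[OF s this] obtain a where a: "0 < a" "a < s"
    and ga: "g s - g 0 = s * (dir_deriv v f (x + a *\<^sub>R v + s *\<^sub>R w) - dir_deriv v f (x + a *\<^sub>R v))"
    by auto
  define d where "d c = dir_deriv v f (x + a *\<^sub>R v + c *\<^sub>R w)" for c
  have "(d has_real_derivative dir_deriv w (dir_deriv v f) (x + a *\<^sub>R v + c *\<^sub>R w)) (at c)"
    if "0 \<le> c" "c \<le> s" for c
    unfolding d_def using line_w[of a c] a that by simp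
  from MVT2[OF s this] obtain c where c: "0 < c" "c < s"
    and dc: "d s - d 0 = s * dir_deriv w (dir_deriv v f) (x + a *\<^sub>R v + c *\<^sub>R w)"
    by auto
  have "g s - g 0 = s * (d s - d 0)" using ga by (simp add: d_def)
  with dc have "g s - g 0 = s\<^sup>2 * dir_deriv w (dir_deriv v f) (x + a *\<^sub>R v + c *\<^sub>R w)"
    by (simp add: power2_eq_square)
  with a c show ?thesis unfolding g_def by (intro exI[of _ a] exI[of _ c]) simp
qed

text \<open>As the parallelogram shrinks to \<open>x\<close>, the two mean values of its second difference tend to the two mixed derivatives at \<open>x\<close>.\<close>

lemma dir_deriv_commute_real:
  fixes f :: "'a::real_normed_vector \<Rightarrow> real"
  assumes "open S" "x \<in> S" and f: "\<And>y. y \<in> S \<Longrightarrow> f differentiable (at y)"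
    and fv: "\<And>y. y \<in> S \<Longrightarrow> dir_deriv v f differentiable (at y)"
    and fw: "\<And>y. y \<in> S \<Longrightarrow> dir_deriv w f differentiable (at y)"
    and fvw: "continuous_on S (dir_deriv w (dir_deriv v f))"
    and fwv: "continuous_on S (dir_deriv v (dir_deriv w f))"
  shows "dir_deriv w (dir_deriv v f) x = dir_deriv v (dir_deriv w f) x"
proof (rule ccontr)
  let ?A = "dir_deriv w (dir_deriv v f)" and ?B = "dir_deriv v (dir_deriv w f)"
  assume "?A x \<noteq> ?B x"
  define e where "e = \<bar>?A x - ?B x\<bar> / 2"
  have e: "0 < e" using \<open>?A x \<noteq> ?B x\<close> by (simp add: e_def)
  have "isCont ?A x" "isCont ?B x"
    using fvw fwv assms(1,2) by (simp_all add: continuous_on_eq_continuous_at)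
  then obtain d1 d2 where d: "0 < d1" "0 < d2"
    and d1: "\<And>y. dist y x < d1 \<Longrightarrow> \<bar>?A y - ?A x\<bar> < e"
    and d2: "\<And>y. dist y x < d2 \<Longrightarrow> \<bar>?B y - ?B x\<bar> < e"
    unfolding continuous_at_eps_delta dist_real_def using e by metis
  obtain d3 where d3: "0 < d3" "ball x d3 \<subseteq> S"
    using assms(1,2) openE by blast
  (* a scale at which both parallelograms lie in S and in the neighbourhoods given by continuity *)
  define s where "s = min d1 (min d2 d3) / (norm v + norm w + 1)"
  have pos: "0 < norm v + norm w + 1" by (smt (verit) norm_ge_zero)
  have s: "0 < s" using d d3 pos by (simp add: s_def)
  have close: "dist (x + a *\<^sub>R v + c *\<^sub>R w) x < min d1 (min d2 d3)"
    if "0 \<le> a" "a \<le> s" "0 \<le> c" "c \<le> s" for a c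
  proof -
    have "dist (x + a *\<^sub>R v + c *\<^sub>R w) x = norm (a *\<^sub>R v + c *\<^sub>R w)"
      by (simp add: dist_norm algebra_simps)
    also have "\<dots> \<le> a * norm v + c * norm w"
      using that norm_triangle_ineq[of "a *\<^sub>R v" "c *\<^sub>R w"] by simp
    also have "\<dots> \<le> s * norm v + s * norm w"
      using that by (intro add_mono mult_right_mono) auto
    also have "\<dots> < s * (norm v + norm w + 1)" using s by (simp add: algebra_simps)
    also have "\<dots> = min d1 (min d2 d3)" using pos by (simp add: s_def)
    finally show ?thesis .
  qed
  have inS: "x + a *\<^sub>R v + c *\<^sub>R w \<in> S" "x + a *\<^sub>R w + c *\<^sub>R v \<in> S"
    if "0 \<le> a" "a \<le> s" "0 \<le> c" "c \<le> s" for a c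
    using close[OF that] close[OF that(3,4,1,2)] d3(2)
    by (auto simp: dist_commute subset_iff add_ac)
  obtain a c where ac: "0 < a" "a < s" "0 < c" "c < s"
    and A: "f (x + s *\<^sub>R v + s *\<^sub>R w) - f (x + s *\<^sub>R v) - f (x + s *\<^sub>R w) + f x =
      s\<^sup>2 * ?A (x + a *\<^sub>R v + c *\<^sub>R w)"
    using second_difference_mean_value[OF s, of f x v w] f fv inS by blast
  obtain a' c' where ac': "0 < a'" "a' < s" "0 < c'" "c' < s"
    and B: "f (x + s *\<^sub>R w + s *\<^sub>R v) - f (x + s *\<^sub>R w) - f (x + s *\<^sub>R v) + f x =
      s\<^sup>2 * ?B (x + a' *\<^sub>R w + c' *\<^sub>R v)"
    using second_difference_mean_value[OF s, of f x w v] f fw inS by blast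
  have "x + s *\<^sub>R w + s *\<^sub>R v = x + s *\<^sub>R v + s *\<^sub>R w" by simp
  then have "f (x + s *\<^sub>R v + s *\<^sub>R w) - f (x + s *\<^sub>R w) - f (x + s *\<^sub>R v) + f x =
      s\<^sup>2 * ?B (x + a' *\<^sub>R w + c' *\<^sub>R v)"
    using B by (simp only:)
  with A have "s\<^sup>2 * ?A (x + a *\<^sub>R v + c *\<^sub>R w) = s\<^sup>2 * ?B (x + a' *\<^sub>R w + c' *\<^sub>R v)"
    by linarith
  then have "?A (x + a *\<^sub>R v + c *\<^sub>R w) = ?B (x + a' *\<^sub>R w + c' *\<^sub>R v)" using s by simp
  moreover have "\<bar>?A (x + a *\<^sub>R v + c *\<^sub>R w) - ?A x\<bar> < e"
    using close[of a c] ac by (intro d1) auto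
  moreover have "\<bar>?B (x + a' *\<^sub>R w + c' *\<^sub>R v) - ?B x\<bar> < e"
    using close[of c' a'] ac' by (intro d2) (auto simp: add_ac)
  moreover have "\<bar>?A x - ?B x\<bar> = 2 * e" by (simp add: e_def)
  ultimately show False by linarith
qed

lemma frechet_derivative_inner_left:
  assumes "f differentiable (at x)"
  shows "frechet_derivative (\<lambda>y. f y \<bullet> b) (at x) = (\<lambda>v. frechet_derivative f (at x) v \<bullet> b)"
  using has_derivative_inner_left[OF assms[unfolded frechet_derivative_works]]
  by (metis frechet_derivative_at)

text \<open>Inner products with fixed vectors reduce the symmetry to real functions.\<close>

lemma dir_deriv_commute:
  fixes f :: "'a::real_normed_vector \<Rightarrow> 'b::real_inner"
  assumes S: "open S" and x: "x \<in> S" and f: "smooth_on S f"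
  shows "dir_deriv w (dir_deriv v f) x = dir_deriv v (dir_deriv w f) x"
proof (rule vector_eq_rdot[THEN iffD1], rule allI)
  fix b :: 'b
  let ?f = "\<lambda>y. f y \<bullet> b"
  have diff: "(\<lambda>y. g y \<bullet> b) differentiable (at y)" if "smooth_on S g" "y \<in> S" for g y
    using has_derivative_inner_left[OF smooth_on_has_derivative[OF that]]
    by (auto simp: differentiable_def)
  have first: "dir_deriv u (\<lambda>y. g y \<bullet> b) y = dir_deriv u g y \<bullet> b" if "smooth_on S g" "y \<in> S" for u g y
    by (simp add: frechet_derivative_inner_left smooth_on_differentiable[OF that])
  have fdiff: "?f differentiable (at y)" if "y \<in> S" for y
    using diff[OF f that] by simp
  have gdiff: "dir_deriv u ?f differentiable (at y)" if "y \<in> S" for u y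
  proof -
    have "((\<lambda>y. dir_deriv u f y \<bullet> b) has_derivative
        (\<lambda>z. frechet_derivative (dir_deriv u f) (at y) z \<bullet> b)) (at y)"
      by (intro has_derivative_inner_left smooth_on_has_derivative[OF smooth_on_dir_deriv[OF f] that])
    then have "(dir_deriv u ?f has_derivative
        (\<lambda>z. frechet_derivative (dir_deriv u f) (at y) z \<bullet> b)) (at y)"
      by (rule has_derivative_transform_within_open[OF _ S that]) (simp add: first[OF f])
    then show ?thesis by (auto simp: differentiable_def)
  qed
  have second: "dir_deriv z (dir_deriv u ?f) y = dir_deriv z (dir_deriv u f) y \<bullet> b"
    if "y \<in> S" for z u y
  proof -
    have "frechet_derivative (\<lambda>y. dir_deriv u f y \<bullet> b) (at y) = frechet_derivative (dir_deriv u ?f) (at y)"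
      by (rule frechet_derivative_transform_within_open[OF _ S that])
         (use diff[OF smooth_on_dir_deriv[OF f] that] in \<open>auto simp: first[OF f]\<close>)
    with first[OF smooth_on_dir_deriv[OF f] that] show ?thesis by metis
  qed
  have cont: "continuous_on S (dir_deriv z (dir_deriv u ?f))" for z u
  proof -
    have "continuous_on S (\<lambda>y. dir_deriv z (dir_deriv u f) y \<bullet> b)"
      by (intro continuous_intros smooth_on_continuous smooth_on_dir_deriv f)
    then show ?thesis by (rule continuous_on_eq) (simp add: second)
  qed
  have "dir_deriv w (dir_deriv v ?f) x = dir_deriv v (dir_deriv w ?f) x"
    by (rule dir_deriv_commute_real[OF S x fdiff gdiff gdiff cont cont])
  then show "dir_deriv w (dir_deriv v f) x \<bullet> b = dir_deriv v (dir_deriv w f) x \<bullet> b"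
    by (simp add: second[OF x])
qed

section \<open>Integrals of derivatives\<close>

text \<open>By the mean value theorem the difference quotients are bounded by the maximum of \<open>m'\<close> over a compact
  interval times \<open>K\<close>, so dominated convergence applies.\<close>

lemma has_real_derivative_set_integral_compact:
  fixes m m' :: "real \<Rightarrow> 'a::euclidean_space \<Rightarrow> real"
  assumes K: "compact K" and e: "0 < e"
    and deriv: "\<And>t p. t \<in> {-e<..<e} \<Longrightarrow> p \<in> K \<Longrightarrow> ((\<lambda>s. m s p) has_real_derivative m' t p) (at t)"
    and m: "\<And>t. t \<in> {-e<..<e} \<Longrightarrow> continuous_on K (m t)"
    and m': "continuous_on ({-e<..<e} \<times> K) (\<lambda>(t, p). m' t p)"
  shows "((\<lambda>t. LINT p:K|lborel. m t p) has_real_derivative (LINT p:K|lborel. m' 0 p)) (at 0)"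
proof -
  let ?J = "{-(e/2)..e/2}"
  have "continuous_on (?J \<times> K) (\<lambda>(t, p). m' t p)"
    by (rule continuous_on_subset[OF m']) (use e in auto)
  then have "bounded ((\<lambda>(t, p). m' t p) ` (?J \<times> K))"
    by (intro compact_imp_bounded compact_continuous_image compact_Times K) auto
  then obtain M where M: "\<And>t p. t \<in> ?J \<Longrightarrow> p \<in> K \<Longrightarrow> \<bar>m' t p\<bar> \<le> M"
    unfolding bounded_iff by (force simp: image_iff)
  have quot: "\<bar>(m t p - m 0 p) / t\<bar> \<le> M" if t: "t \<in> ?J" "t \<noteq> 0" and p: "p \<in> K" for t p
  proof -
    have "norm (m t p - m 0 p) \<le> M * norm (t - 0)"
    proof (rule field_differentiable_bound[of "?J" "\<lambda>s. m s p" "\<lambda>s. m' s p"])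
      show "((\<lambda>s. m s p) has_real_derivative m' s p) (at s within ?J)" if "s \<in> ?J" for s
        using deriv[of s p] that e p by (auto intro: has_field_derivative_at_within)
    qed (use M t p e in auto)
    then show ?thesis using t by (simp add: divide_le_eq)
  qed
  have int: "integrable lborel (\<lambda>p. indicator K p *\<^sub>R m t p)" if "t \<in> {-e<..<e}" for t
    by (rule borel_integrable_compact[OF K m[OF that]])
  have "continuous_on K (\<lambda>p. m' 0 p)"
  proof -
    have "continuous_on K ((\<lambda>(t, p). m' t p) \<circ> (\<lambda>p. (0, p)))"
      by (intro continuous_on_compose continuous_intros continuous_on_subset[OF m']) (use e in auto)
    then show ?thesis by (simp add: o_def)
  qed
  from borel_integrable_compact[OF K this]
  have meas': "(\<lambda>p. indicator K p *\<^sub>R m' 0 p) \<in> borel_measurable lborel" by auto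
  have "((\<lambda>t. ((LINT p:K|lborel. m t p) - (LINT p:K|lborel. m 0 p)) / (t - 0)) \<longlongrightarrow>
      (LINT p:K|lborel. m' 0 p)) (at 0)"
    unfolding tendsto_at_iff_sequentially comp_def
  proof (intro allI impI)
    fix X :: "nat \<Rightarrow> real"
    assume X0: "\<forall>i. X i \<in> UNIV - {0}" and X: "X \<longlonglongrightarrow> 0"
    obtain n0 where n0: "\<And>n. n \<ge> n0 \<Longrightarrow> \<bar>X n\<bar> < e/2"
      using X e unfolding LIMSEQ_iff by (metis diff_zero half_gt_zero real_norm_def)
    define Y where "Y n = X (n + n0)" for n
    have Y: "Y \<longlonglongrightarrow> 0" unfolding Y_def using LIMSEQ_ignore_initial_segment[OF X] .
    have YJ: "Y n \<in> ?J" "Y n \<in> {-e<..<e}" "Y n \<noteq> 0" for n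
      using n0[of "n + n0"] X0 e by (auto simp: Y_def abs_less_iff)
    let ?q = "\<lambda>n p. indicator K p *\<^sub>R ((m (Y n) p - m 0 p) / Y n)"
    have q: "?q n = (\<lambda>p. (indicator K p *\<^sub>R m (Y n) p - indicator K p *\<^sub>R m 0 p) / Y n)" for n
      by (auto simp: fun_eq_iff field_simps diff_divide_distrib)
    have lim: "(\<lambda>n. LINT p|lborel. ?q n p) \<longlonglongrightarrow> (LINT p|lborel. indicator K p *\<^sub>R m' 0 p)"
    proof (rule integral_dominated_convergence[where w = "\<lambda>p. indicator K p *\<^sub>R M"])
      show "integrable lborel (\<lambda>p. indicator K p *\<^sub>R M)"
        by (rule borel_integrable_compact[OF K]) simp
      show "?q n \<in> borel_measurable lborel" for n
        unfolding q using int[OF YJ(2)[of n]] int[of 0] e by (intro borel_measurable_divide borel_measurable_diff) auto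
      show "AE p in lborel. norm (?q n p) \<le> indicator K p *\<^sub>R M" for n
        using quot[OF YJ(1,3)] by (auto split: split_indicator)
      show "AE p in lborel. (\<lambda>n. ?q n p) \<longlonglongrightarrow> indicator K p *\<^sub>R m' 0 p"
      proof (intro AE_I2)
        fix p
        show "(\<lambda>n. ?q n p) \<longlonglongrightarrow> indicator K p *\<^sub>R m' 0 p"
        proof (cases "p \<in> K")
          case True
          have "((\<lambda>t. (m t p - m 0 p) / (t - 0)) \<longlongrightarrow> m' 0 p) (at 0)"
            using deriv[of 0 p] True e by (simp add: has_field_derivative_iff)
          then have "(\<lambda>n. (m (Y n) p - m 0 p) / Y n) \<longlonglongrightarrow> m' 0 p"
            unfolding tendsto_at_iff_sequentially comp_def using Y YJ(3) by auto
          with True show ?thesis by simp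
        qed simp
      qed
    qed (use meas' in auto)
    have eq: "(LINT p|lborel. ?q n p) =
        ((LINT p:K|lborel. m (Y n) p) - (LINT p:K|lborel. m 0 p)) / (Y n - 0)" for n
      unfolding q set_lebesgue_integral_def using int[OF YJ(2)[of n]] int[of 0] e by simp
    have "(\<lambda>n. ((LINT p:K|lborel. m (X (n + n0)) p) - (LINT p:K|lborel. m 0 p)) / (X (n + n0) - 0))
        \<longlonglongrightarrow> (LINT p:K|lborel. m' 0 p)"
      using lim unfolding eq unfolding Y_def set_lebesgue_integral_def .
    then show "(\<lambda>i. ((LINT p:K|lborel. m (X i) p) - (LINT p:K|lborel. m 0 p)) / (X i - 0)) \<longlonglongrightarrow>
        (LINT p:K|lborel. m' 0 p)"
      by (rule LIMSEQ_offset)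
  qed
  then show ?thesis by (simp add: has_field_derivative_iff)
qed

text \<open>The integral of \<open>u (p + t v)\<close> over the whole space is independent of \<open>t\<close> by translation invariance; its
  derivative at \<open>t = 0\<close> is the integral of \<open>u'\<close>. This gives the divergence theorem for compact supports
  without iterated integrals.\<close>

lemma integral_directional_derivative_eq_0:
  fixes u u' :: "'a::euclidean_space \<Rightarrow> real"
  assumes K: "compact K" and supp: "\<And>p. p \<notin> K \<Longrightarrow> u p = 0"
    and u: "continuous_on UNIV u" and u': "continuous_on UNIV u'"
    and deriv: "\<And>p. ((\<lambda>s. u (p + s *\<^sub>R v)) has_real_derivative u' p) (at 0)"
  shows "(LINT p:K|lborel. u' p) = 0"
proof -
  define K2 where "K2 = (\<lambda>(s, p). p + s *\<^sub>R v) ` ({-1..1} \<times> K)"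
  have K2: "compact K2" unfolding K2_def case_prod_beta
    by (intro compact_continuous_image compact_Times K continuous_intros) auto
  have sub: "K \<subseteq> K2" unfolding K2_def by (force simp: image_iff)
  have u'0: "u' p = 0" if "p \<notin> K" for p
  proof -
    have "open (-K)" using K by (simp add: compact_imp_closed open_Compl)
    then have "open ((\<lambda>s. p + s *\<^sub>R v) -` (-K))"
      by (rule open_vimage) (intro continuous_intros)
    then have "((\<lambda>s. u (p + s *\<^sub>R v)) has_real_derivative 0) (at 0)"
      by (rule has_field_derivative_transform_within_open[OF DERIV_const]) (use that supp in auto)
    with deriv show ?thesis by (rule DERIV_unique)
  qed
  have shift: "(LINT p:K2|lborel. u (p + t *\<^sub>R v)) = (LINT p|lborel. u p)" if t: "t \<in> {-1<..<1}" for t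
  proof -
    have "indicator K2 p *\<^sub>R u (p + t *\<^sub>R v) = u (t *\<^sub>R v + p)" for p
    proof (cases "p \<in> K2")
      case False
      have "p + t *\<^sub>R v \<notin> K"
      proof
        assume "p + t *\<^sub>R v \<in> K"
        then have "(\<lambda>(s, p). p + s *\<^sub>R v) (-t, p + t *\<^sub>R v) \<in> K2"
          unfolding K2_def using t by (intro imageI) auto
        with False show False by simp
      qed
      with False supp show ?thesis by (simp add: add.commute)
    qed (simp add: add.commute)
    then have "(LINT p:K2|lborel. u (p + t *\<^sub>R v)) = (LINT p|lborel. u (t *\<^sub>R v + p))"
      by (simp add: set_lebesgue_integral_def)
    also have "\<dots> = (LINT p|distr lborel borel ((+) (t *\<^sub>R v)). u p)"
      by (rule integral_distr[symmetric])
         (use u in \<open>auto intro: borel_measurable_continuous_onI\<close>)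
    finally show ?thesis by (simp add: lborel_distr_plus)
  qed
  have "((\<lambda>t. LINT p:K2|lborel. u (p + t *\<^sub>R v)) has_real_derivative
      (LINT p:K2|lborel. u' (p + 0 *\<^sub>R v))) (at 0)"
  proof (rule has_real_derivative_set_integral_compact[OF K2, of 1])
    show "((\<lambda>s. u (p + s *\<^sub>R v)) has_real_derivative u' (p + t *\<^sub>R v)) (at t)" for t p
      using deriv[of "p + t *\<^sub>R v"] DERIV_shift[of "\<lambda>s. u (p + s *\<^sub>R v)" _ 0 t]
      by (simp add: algebra_simps)
    show "continuous_on ({-1<..<1} \<times> K2) (\<lambda>(t, p). u' (p + t *\<^sub>R v))"
      unfolding case_prod_beta by (intro continuous_on_compose2[OF u'] continuous_intros) auto
    show "continuous_on K2 (\<lambda>p. u (p + t *\<^sub>R v))" for t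
      by (rule continuous_on_compose2[OF u]) (auto intro: continuous_on_add continuous_on_id continuous_on_const)
  qed simp
  moreover have "((\<lambda>t. LINT p:K2|lborel. u (p + t *\<^sub>R v)) has_real_derivative 0) (at 0)"
    by (rule has_field_derivative_transform_within_open[OF DERIV_const, of "{-1<..<1}"])
       (auto simp: shift)
  ultimately have "(LINT p:K2|lborel. u' p) = 0" using DERIV_unique by fastforce
  moreover have "(\<lambda>p. indicator K2 p *\<^sub>R u' p) = (\<lambda>p. indicator K p *\<^sub>R u' p)"
    using u'0 sub by (auto simp: fun_eq_iff indicator_def)
  ultimately show ?thesis by (simp add: set_lebesgue_integral_def)
qed

text \<open>Extension by zero outside \<open>K\<close> reduces the local form to the global one: \<open>D\<close> and the complement of \<open>K\<close>
  are open and cover the space, and the extension is continuously differentiable on both.\<close>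

lemma set_integral_directional_derivative_eq_0:
  fixes u u' :: "'a::euclidean_space \<Rightarrow> real"
  assumes D: "open D" and K: "compact K" "K \<subseteq> D" and supp: "\<And>p. p \<in> D - K \<Longrightarrow> u p = 0"
    and u: "continuous_on D u" and u': "continuous_on D u'"
    and deriv: "\<And>p. p \<in> D \<Longrightarrow> ((\<lambda>s. u (p + s *\<^sub>R v)) has_real_derivative u' p) (at 0)"
  shows "(LINT p:K|lborel. u' p) = 0"
proof -
  define U where "U p = (if p \<in> K then u p else 0)" for p
  define U' where "U' p = (if p \<in> K then u' p else 0)" for p
  have oK: "open (-K)" using K by (simp add: compact_imp_closed open_Compl)
  have nbhd: "open ((\<lambda>s. p + s *\<^sub>R v) -` X)" if "open X" for p X
    using that by (rule open_vimage) (intro continuous_intros)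
  have UD: "U p = u p" if "p \<in> D" for p using that supp by (auto simp: U_def)
  have dU: "((\<lambda>s. U (p + s *\<^sub>R v)) has_real_derivative u' p) (at 0)" if "p \<in> D" for p
    by (rule has_field_derivative_transform_within_open[OF deriv[OF that] nbhd[OF D, of p]])
       (use that UD in auto)
  have dU0: "((\<lambda>s. U (p + s *\<^sub>R v)) has_real_derivative 0) (at 0)" if "p \<notin> K" for p
    by (rule has_field_derivative_transform_within_open[OF DERIV_const nbhd[OF oK, of p]])
       (use that in \<open>auto simp: U_def\<close>)
  have U'D: "U' p = u' p" if "p \<in> D" for p
    using that dU[OF that] dU0[of p] DERIV_unique by (fastforce simp: U'_def)
  have "UNIV = D \<union> -K" using K by auto
  have glue: "continuous_on UNIV g" if "continuous_on D g" "\<And>p. p \<notin> K \<Longrightarrow> g p = 0" for g :: "'a \<Rightarrow> real"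
  proof -
    have "continuous_on (-K) g" by (rule continuous_on_eq[of _ "\<lambda>_. 0"]) (use that(2) in auto)
    then have "continuous_on (D \<union> -K) g" using that(1) D oK by (intro continuous_on_open_Un)
    then show ?thesis using \<open>UNIV = D \<union> -K\<close> by simp
  qed
  have "(LINT p:K|lborel. U' p) = 0"
  proof (rule integral_directional_derivative_eq_0[OF K(1), of U])
    show "continuous_on UNIV U"
      by (rule glue) (use continuous_on_eq[OF u] UD in \<open>auto simp: U_def\<close>)
    show "continuous_on UNIV U'"
      by (rule glue) (use continuous_on_eq[OF u'] U'D in \<open>auto simp: U'_def\<close>)
    show "((\<lambda>s. U (p + s *\<^sub>R v)) has_real_derivative U' p) (at 0)" for p
      using dU[of p] dU0[of p] U'D[of p] K by (cases "p \<in> K") (auto simp: U'_def)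
  qed (simp add: U_def)
  moreover have "(\<lambda>p. indicator K p *\<^sub>R U' p) = (\<lambda>p. indicator K p *\<^sub>R u' p)"
    by (auto simp: fun_eq_iff U'_def)
  ultimately show ?thesis by (simp add: set_lebesgue_integral_def)
qed

section \<open>Operations on smooth functions\<close>

lemma higher_differentiable_on_cong:
  assumes "open S" "\<And>x. x \<in> S \<Longrightarrow> f x = g x" "higher_differentiable_on S n f"
  shows "higher_differentiable_on S n g"
  using assms(2,3)
proof (induction n arbitrary: f g)
  case 0
  then show ?case using continuous_on_eq[of S f g] by simp
next
  case (Suc n)
  have fd: "f differentiable (at x)" if "x \<in> S" for x using Suc.prems(2) that by simp
  have "g differentiable (at x)" if "x \<in> S" for x
    using has_derivative_transform_within_open[OF _ \<open>open S\<close> that, of f _ UNIV g] fd[OF that] Suc.prems(1)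
    by (auto simp: differentiable_def)
  moreover have "higher_differentiable_on S n (dir_deriv v g)" for v
  proof (rule Suc.IH)
    show "dir_deriv v f x = dir_deriv v g x" if "x \<in> S" for x
      using frechet_derivative_transform_within_open[OF fd[OF that] \<open>open S\<close> that, of g] Suc.prems(1)
      by simp
    show "higher_differentiable_on S n (dir_deriv v f)" using Suc.prems(2) by simp
  qed
  ultimately show ?case by simp
qed

lemma higher_differentiable_on_SucD:
  "higher_differentiable_on S (Suc n) f \<Longrightarrow> higher_differentiable_on S n f"
proof (induction n arbitrary: f)
  case 0
  then show ?case
    by (auto intro!: continuous_at_imp_continuous_on differentiable_imp_continuous_within)
qed auto

lemma higher_differentiable_on_SucI:
  assumes "open S" and "\<And>x. x \<in> S \<Longrightarrow> (f has_derivative f' x) (at x)"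
    and "\<And>v. higher_differentiable_on S n (\<lambda>x. f' x v)"
  shows "higher_differentiable_on S (Suc n) f"
proof -
  have "f' x = frechet_derivative f (at x)" if "x \<in> S" for x
    using frechet_derivative_at assms(2)[OF that] by blast
  then have "higher_differentiable_on S n (dir_deriv v f)" for v
    by (intro higher_differentiable_on_cong[OF assms(1) _ assms(3)[of v]]) simp
  with assms(2) show ?thesis by (auto simp: differentiable_def)
qed

lemma higher_differentiable_on_const: "higher_differentiable_on S n (\<lambda>_. c)"
  by (induction n arbitrary: c) simp_all

lemma higher_differentiable_on_bounded_linear:
  assumes "bounded_linear f" shows "higher_differentiable_on S n f"
proof (cases n)
  case 0
  then show ?thesis using assms by (simp add: linear_continuous_on)
next
  case (Suc m)
  have "frechet_derivative f (at x) = f" for x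
    by (metis assms bounded_linear_imp_has_derivative frechet_derivative_at)
  then show ?thesis
    using Suc assms by (simp add: higher_differentiable_on_const bounded_linear_imp_differentiable)
qed

lemma higher_differentiable_on_has_derivative:
  "higher_differentiable_on S (Suc n) f \<Longrightarrow> x \<in> S \<Longrightarrow>
    (f has_derivative frechet_derivative f (at x)) (at x)"
  by (simp add: frechet_derivative_works)

lemma higher_differentiable_on_add:
  assumes S: "open S" and "higher_differentiable_on S n f" "higher_differentiable_on S n g"
  shows "higher_differentiable_on S n (\<lambda>x. f x + g x)"
  using assms(2,3)
proof (induction n arbitrary: f g)
  case (Suc n)
  show ?case
  proof (rule higher_differentiable_on_SucI[OF S])
    show "((\<lambda>x. f x + g x) has_derivative (\<lambda>v. dir_deriv v f x + dir_deriv v g x)) (at x)"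
      if "x \<in> S" for x
      using Suc.prems that by (intro has_derivative_add higher_differentiable_on_has_derivative)
    show "higher_differentiable_on S n (\<lambda>x. dir_deriv v f x + dir_deriv v g x)" for v
      using Suc.prems by (intro Suc.IH) simp_all
  qed
qed (auto intro: continuous_on_add)

lemma higher_differentiable_on_scaleR:
  fixes f :: "'a::real_normed_vector \<Rightarrow> real"
  assumes S: "open S" and "higher_differentiable_on S n f" "higher_differentiable_on S n g"
  shows "higher_differentiable_on S n (\<lambda>x. f x *\<^sub>R g x)"
  using assms(2,3)
proof (induction n arbitrary: f g)
  case (Suc n)
  show ?case
  proof (rule higher_differentiable_on_SucI[OF S])
    show "((\<lambda>x. f x *\<^sub>R g x) has_derivative (\<lambda>v. f x *\<^sub>R dir_deriv v g x + dir_deriv v f x *\<^sub>R g x)) (at x)"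
      if "x \<in> S" for x
      using Suc.prems that by (intro has_derivative_scaleR higher_differentiable_on_has_derivative)
    show "higher_differentiable_on S n (\<lambda>x. f x *\<^sub>R dir_deriv v g x + dir_deriv v f x *\<^sub>R g x)" for v
      using Suc.prems Suc.prems[THEN higher_differentiable_on_SucD]
      by (intro higher_differentiable_on_add[OF S] Suc.IH) simp_all
  qed
qed (auto intro: continuous_on_scaleR)

text \<open>The derivative of \<open>g \<circ> u\<close> is the derivative of \<open>u\<close> scaled by the real function \<open>g' \<circ> u\<close>, so the product
  rule and an induction over all \<open>g\<close> suffice.\<close>

lemma higher_differentiable_on_compose_real:
  fixes g :: "real \<Rightarrow> real" and u :: "'a::real_normed_vector \<Rightarrow> real"
  assumes S: "open S" and "higher_differentiable_on S n u" "higher_differentiable_on T n g"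
    and uS: "\<And>x. x \<in> S \<Longrightarrow> u x \<in> T"
  shows "higher_differentiable_on S n (\<lambda>x. g (u x))"
  using assms(2,3)
proof (induction n arbitrary: g)
  case 0
  then show ?case using continuous_on_compose2[of T g S u] uS by auto
next
  case (Suc n)
  show ?case
  proof (rule higher_differentiable_on_SucI[OF S])
    fix x assume x: "x \<in> S"
    note g' = higher_differentiable_on_has_derivative[OF Suc.prems(2) uS[OF x]]
    have "dir_deriv r g (u x) = r *\<^sub>R dir_deriv 1 g (u x)" for r
      using linear_cmul[OF has_derivative_linear[OF g'], of r 1] by simp
    then have "(\<lambda>v. dir_deriv (dir_deriv v u x) g (u x)) = (\<lambda>v. dir_deriv v u x *\<^sub>R dir_deriv 1 g (u x))"
      by (rule ext)
    with has_derivative_compose[OF higher_differentiable_on_has_derivative[OF Suc.prems(1) x] g']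
    show "((\<lambda>x. g (u x)) has_derivative (\<lambda>v. dir_deriv v u x *\<^sub>R dir_deriv 1 g (u x))) (at x)"
      by metis
  next
    show "higher_differentiable_on S n (\<lambda>x. dir_deriv v u x *\<^sub>R dir_deriv 1 g (u x))" for v
      using Suc.prems
      by (intro higher_differentiable_on_scaleR[OF S _ Suc.IH[OF higher_differentiable_on_SucD]]) simp_all
  qed
qed

lemma higher_differentiable_on_sin_cos:
  "higher_differentiable_on UNIV n (sin :: real \<Rightarrow> real) \<and> higher_differentiable_on UNIV n (cos :: real \<Rightarrow> real)"
proof (induction n)
  case 0
  show ?case by (simp add: continuous_on_sin continuous_on_cos)
next
  case (Suc n)
  have scaled: "higher_differentiable_on UNIV n (\<lambda>x::real. c *\<^sub>R f x)"
    if "higher_differentiable_on UNIV n f" for c and f :: "real \<Rightarrow> real"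
    by (intro higher_differentiable_on_scaleR higher_differentiable_on_const that) simp
  have ds: "(sin has_derivative (\<lambda>v. v *\<^sub>R cos x)) (at x)" for x :: real
    by (auto intro!: derivative_eq_intros)
  have dc: "(cos has_derivative (\<lambda>v. (- v) *\<^sub>R sin x)) (at x)" for x :: real
    by (auto intro!: derivative_eq_intros)
  have "higher_differentiable_on UNIV (Suc n) (sin :: real \<Rightarrow> real)"
    by (rule higher_differentiable_on_SucI[OF open_UNIV ds scaled[OF conjunct2[OF Suc]]])
  moreover have "higher_differentiable_on UNIV (Suc n) (cos :: real \<Rightarrow> real)"
    by (rule higher_differentiable_on_SucI[OF open_UNIV dc scaled[OF conjunct1[OF Suc]]])
  ultimately show ?case ..
qed

lemma smooth_on_const: "smooth_on S (\<lambda>_. c)"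
  unfolding smooth_on_def by (intro allI higher_differentiable_on_const)

lemma smooth_on_bounded_linear: "bounded_linear f \<Longrightarrow> smooth_on S f"
  unfolding smooth_on_def by (intro allI higher_differentiable_on_bounded_linear)

lemma smooth_on_add:
  "open S \<Longrightarrow> smooth_on S f \<Longrightarrow> smooth_on S g \<Longrightarrow> smooth_on S (\<lambda>x. f x + g x)"
  unfolding smooth_on_def by (intro allI, rule higher_differentiable_on_add) auto

lemma smooth_on_scaleR:
  fixes f :: "'a::real_normed_vector \<Rightarrow> real"
  shows "open S \<Longrightarrow> smooth_on S f \<Longrightarrow> smooth_on S g \<Longrightarrow> smooth_on S (\<lambda>x. f x *\<^sub>R g x)"
  unfolding smooth_on_def by (intro allI, rule higher_differentiable_on_scaleR) auto

lemma smooth_on_mult: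
  fixes f g :: "'a::real_normed_vector \<Rightarrow> real"
  shows "open S \<Longrightarrow> smooth_on S f \<Longrightarrow> smooth_on S g \<Longrightarrow> smooth_on S (\<lambda>x. f x * g x)"
  using smooth_on_scaleR[of S f g] unfolding real_scaleR_def .

lemma smooth_on_diff:
  fixes f g :: "'a::real_normed_vector \<Rightarrow> real"
  assumes "open S" "smooth_on S f" "smooth_on S g" shows "smooth_on S (\<lambda>x. f x - g x)"
proof -
  have "smooth_on S (\<lambda>x. (-1) * g x)" by (rule smooth_on_mult[OF assms(1) smooth_on_const assms(3)])
  from smooth_on_add[OF assms(1,2) this] show ?thesis by simp
qed

lemma smooth_on_compose_real:
  fixes g :: "real \<Rightarrow> real" and u :: "'a::real_normed_vector \<Rightarrow> real"
  assumes "open S" "smooth_on S u" "smooth_on T g" "\<And>x. x \<in> S \<Longrightarrow> u x \<in> T"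
  shows "smooth_on S (\<lambda>x. g (u x))"
  unfolding smooth_on_def
proof
  fix n
  have "higher_differentiable_on S n u" "higher_differentiable_on T n g"
    using assms(2,3) unfolding smooth_on_def by blast+
  from higher_differentiable_on_compose_real[of S n u T g, OF assms(1) this assms(4)]
  show "higher_differentiable_on S n (\<lambda>x. g (u x))" by assumption
qed

lemma smooth_on_sin:
  fixes u :: "'a::real_normed_vector \<Rightarrow> real"
  assumes "open S" "smooth_on S u"
  shows "smooth_on S (\<lambda>x. sin (u x))"
proof -
  have "smooth_on UNIV (sin :: real \<Rightarrow> real)"
    unfolding smooth_on_def by (rule allI, rule conjunct1[OF higher_differentiable_on_sin_cos])
  from smooth_on_compose_real[of S u UNIV sin, OF assms this] show ?thesis by blast
qed

lemma smooth_on_cos: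
  fixes u :: "'a::real_normed_vector \<Rightarrow> real"
  assumes "open S" "smooth_on S u"
  shows "smooth_on S (\<lambda>x. cos (u x))"
proof -
  have "smooth_on UNIV (cos :: real \<Rightarrow> real)"
    unfolding smooth_on_def by (rule allI, rule conjunct2[OF higher_differentiable_on_sin_cos])
  from smooth_on_compose_real[of S u UNIV cos, OF assms this] show ?thesis by blast
qed

text \<open>The functions \<open>q (1/x) exp (-1/x)\<close> on the positive axis, extended by zero. Differentiation maps this family into itself
  by \<open>q \<mapsto> X\<^sup>2 (q - q')\<close>, which makes its members smooth; \<open>q = 1\<close> is the standard source of bump functions.\<close>

definition flat_exp :: "real poly \<Rightarrow> real \<Rightarrow> real" where
  "flat_exp q x = (if x \<le> 0 then 0 else poly q (1 / x) * exp (- (1 / x)))"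

lemma poly_times_exp_minus_tendsto_0:
  fixes q :: "real poly"
  shows "((\<lambda>y. poly q y * exp (- y)) \<longlongrightarrow> 0) at_top"
proof -
  have "((\<lambda>y. \<Sum>i\<le>degree q. coeff q i * (y ^ i / exp y)) \<longlongrightarrow> (\<Sum>i\<le>degree q. coeff q i * 0)) at_top"
    by (intro tendsto_sum tendsto_mult tendsto_const tendsto_power_div_exp_0)
  then show ?thesis
    by (simp add: poly_altdef sum_distrib_right exp_minus divide_inverse mult.assoc)
qed

lemma flat_exp_has_derivative:
  "(flat_exp q has_real_derivative flat_exp ([:0, 0, 1:] * (q - pderiv q)) x) (at x)"
proof (cases x "0::real" rule: linorder_cases)
  case less
  have "(flat_exp q has_real_derivative 0) (at x)"
    by (rule has_field_derivative_transform_within_open[OF DERIV_const, of "{..<0}"])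
       (use less in \<open>auto simp: flat_exp_def\<close>)
  with less show ?thesis by (simp add: flat_exp_def)
next
  case greater
  have inv: "((\<lambda>x. 1 / x) has_real_derivative - (1 / x\<^sup>2)) (at x)"
    using greater by (auto intro!: derivative_eq_intros simp: power2_eq_square)
  have "((\<lambda>x. poly q (1 / x)) has_real_derivative poly (pderiv q) (1 / x) * - (1 / x\<^sup>2)) (at x)"
    by (rule DERIV_chain2[OF poly_DERIV inv])
  moreover have "((\<lambda>x. exp (- (1 / x))) has_real_derivative exp (- (1 / x)) * (1 / x\<^sup>2)) (at x)"
    using DERIV_chain2[OF DERIV_exp DERIV_minus[OF inv]] by simp
  ultimately have "((\<lambda>x. poly q (1 / x) * exp (- (1 / x))) has_real_derivative
      flat_exp ([:0, 0, 1:] * (q - pderiv q)) x) (at x)"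
    by (rule DERIV_cong[OF DERIV_mult])
       (use greater in \<open>simp add: flat_exp_def power2_eq_square algebra_simps\<close>)
  then show ?thesis
    by (rule has_field_derivative_transform_within_open[of _ _ _ "{0<..}"])
       (use greater in \<open>auto simp: flat_exp_def\<close>)
next
  case equal
  have "((\<lambda>y. flat_exp q y / y) \<longlongrightarrow> 0) (at_right 0)"
  proof -
    have "((\<lambda>y. poly ([:0, 1:] * q) (inverse y) * exp (- inverse y)) \<longlongrightarrow> 0) (at_right 0)"
      by (rule filterlim_compose[OF poly_times_exp_minus_tendsto_0 filterlim_inverse_at_top_right])
    moreover have "\<forall>\<^sub>F y in at_right 0. poly ([:0, 1:] * q) (inverse y) * exp (- inverse y) = flat_exp q y / y"
      unfolding eventually_at_right_field
      by (rule exI[of _ 1]) (auto simp: flat_exp_def field_simps)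
    ultimately show ?thesis by (rule Lim_transform_eventually)
  qed
  moreover have "((\<lambda>y. flat_exp q y / y) \<longlongrightarrow> 0) (at_left 0)"
  proof -
    have "\<forall>\<^sub>F y in at_left (0::real). 0 = flat_exp q y / y"
      unfolding eventually_at_left_field
      by (rule exI[of _ "-1"]) (auto simp: flat_exp_def)
    then show ?thesis by (rule Lim_transform_eventually[OF tendsto_const])
  qed
  ultimately have "((\<lambda>y. flat_exp q y / y) \<longlongrightarrow> 0) (at 0)"
    by (simp add: filterlim_split_at)
  then show ?thesis using equal by (simp add: has_field_derivative_iff flat_exp_def)
qed

lemma smooth_on_flat_exp: "smooth_on UNIV (flat_exp q)"
proof -
  have "higher_differentiable_on UNIV n (flat_exp q)" for n
  proof (induction n arbitrary: q)
    case 0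
    have "isCont (flat_exp q) x" for x using flat_exp_has_derivative by (rule DERIV_isCont)
    then show ?case by (simp add: continuous_at_imp_continuous_on)
  next
    case (Suc n)
    show ?case
    proof (rule higher_differentiable_on_SucI)
      show "(flat_exp q has_derivative (\<lambda>v. v *\<^sub>R flat_exp ([:0, 0, 1:] * (q - pderiv q)) x)) (at x)" for x
        by (rule has_derivative_eq_rhs[OF flat_exp_has_derivative[unfolded has_field_derivative_def]])
           (simp add: fun_eq_iff)
      show "higher_differentiable_on UNIV n (\<lambda>x. v *\<^sub>R flat_exp ([:0, 0, 1:] * (q - pderiv q)) x)" for v
        by (rule higher_differentiable_on_scaleR[OF open_UNIV higher_differentiable_on_const Suc.IH])
    qed simp
  qed
  then show ?thesis by (simp add: smooth_on_def)
qed

section \<open>The geometry of a rotation surface\<close>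

text \<open>An orthonormal frame of the ambient 3-space adapted to the axis of rotation, which is spanned by the first
  coordinate vector.\<close>

definition pole :: "real^3" where "pole = axis 1 1"

definition radial :: "real \<Rightarrow> real^3" where
  "radial \<theta> = cos \<theta> *\<^sub>R axis 2 1 + sin \<theta> *\<^sub>R axis 3 1"

definition angular :: "real \<Rightarrow> real^3" where
  "angular \<theta> = cos \<theta> *\<^sub>R axis 3 1 - sin \<theta> *\<^sub>R axis 2 1"

lemma inner_frame [simp]:
  "pole \<bullet> pole = 1" "pole \<bullet> radial \<theta> = 0" "radial \<theta> \<bullet> pole = 0" "radial \<theta> \<bullet> radial \<theta> = 1"
  "angular \<theta> \<bullet> angular \<theta> = 1" "angular \<theta> \<bullet> pole = 0" "pole \<bullet> angular \<theta> = 0"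
  "angular \<theta> \<bullet> radial \<theta> = 0" "radial \<theta> \<bullet> angular \<theta> = 0"
  by (simp_all add: pole_def radial_def angular_def inner_axis_axis algebra_simps
      power2_eq_square[symmetric])

lemma has_derivative_radial [derivative_intros]:
  "(u has_derivative u') (at x within S) \<Longrightarrow>
    ((\<lambda>x. radial (u x)) has_derivative (\<lambda>v. u' v *\<^sub>R angular (u x))) (at x within S)"
  unfolding radial_def angular_def by (auto intro!: derivative_eq_intros simp: algebra_simps)

lemma has_derivative_angular [derivative_intros]:
  "(u has_derivative u') (at x within S) \<Longrightarrow>
    ((\<lambda>x. angular (u x)) has_derivative (\<lambda>v. - u' v *\<^sub>R radial (u x))) (at x within S)"
  unfolding radial_def angular_def by (auto intro!: derivative_eq_intros simp: algebra_simps)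

lemma has_derivative_component: "((\<lambda>p. p $ i) has_derivative (\<lambda>v. v $ i)) (at x within S)"
  by (rule bounded_linear_imp_has_derivative) (rule bounded_linear_vec_nth)

lemma partial_derivI: "(u has_derivative u') (at p) \<Longrightarrow> partial_deriv i u p = u' (axis i 1)"
  unfolding partial_deriv_def using frechet_derivative_at by metis

lemma partial_deriv_cong:
  assumes "open D" "p \<in> D" "\<And>q. q \<in> D \<Longrightarrow> u q = v q"
  shows "partial_deriv i u p = partial_deriv i v p"
proof -
  have *: "(u has_derivative u') (at p) = (v has_derivative u') (at p)" for u'
    using assms has_derivative_transform_within_open[of _ _ p UNIV D] by metis
  then show ?thesis unfolding partial_deriv_def frechet_derivative_def by simp
qed

lemma matrix_inv_diagonal_2:
  fixes A :: "real^2^2"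
  assumes "A $ 1 $ 2 = 0" "A $ 2 $ 1 = 0" "A $ 1 $ 1 \<noteq> 0" "A $ 2 $ 2 \<noteq> 0"
  shows "matrix_inv A = (\<chi> i j. if i = j then 1 / A $ i $ i else 0)"
proof -
  let ?B = "\<chi> i j. if i = j then 1 / A $ i $ i else 0"
  have AB: "A ** ?B = mat 1" "?B ** A = mat 1"
    using assms by (auto simp: matrix_matrix_mult_def mat_def vec_eq_iff forall_2 sum_2)
  have inv: "A ** matrix_inv A = mat 1 \<and> matrix_inv A ** A = mat 1"
    unfolding matrix_inv_def by (rule someI[where x = ?B]) (use AB in auto)
  have "matrix_inv A = matrix_inv A ** (A ** ?B)" unfolding AB(1) by (rule matrix_mul_rid[symmetric])
  also have "\<dots> = (matrix_inv A ** A) ** ?B" by (rule matrix_mul_assoc)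
  also have "\<dots> = ?B" unfolding conjunct2[OF inv] by (rule matrix_mul_lid)
  finally show ?thesis .
qed

locale rotation_patch =
  fixes D :: "(real^2) set" and k h :: "real \<Rightarrow> real"
  assumes open_D: "open D" and connected_D: "connected D"
    and smooth_k: "smooth_on ((\<lambda>p. p $ 1) ` D) k"
    and smooth_h: "smooth_on ((\<lambda>p. p $ 1) ` D) h"
    and immersed: "immersed_surface D (rotation_surface k h)"
begin

abbreviation "\<phi> \<equiv> rotation_surface k h"
abbreviation "g \<equiv> induced_metric \<phi>"
abbreviation "I \<equiv> (\<lambda>p. p $ 1) ` D"

abbreviation "k1 \<equiv> dir_deriv 1 k"
abbreviation "k2 \<equiv> dir_deriv 1 k1"
abbreviation "h1 \<equiv> dir_deriv 1 h"
abbreviation "h2 \<equiv> dir_deriv 1 h1"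

text \<open>The position vector \<open>X\<close> in \<open>S\<^sup>2\<close>. The unit tangent \<open>N\<close> of its meridian, defined next, satisfies
  \<open>X\<^sub>r = k' N\<close> and \<open>N\<^sub>r = - k' X\<close>; with \<open>angular \<theta>\<close> the two form an orthonormal frame along the surface.\<close>

definition sphere_part :: "real^2 \<Rightarrow> real^3" where
  "sphere_part p = sin (k (p $ 1)) *\<^sub>R pole + cos (k (p $ 1)) *\<^sub>R radial (p $ 2)"

definition meridian :: "real^2 \<Rightarrow> real^3" where
  "meridian p = cos (k (p $ 1)) *\<^sub>R pole - sin (k (p $ 1)) *\<^sub>R radial (p $ 2)"

lemma smooth_real_has_derivative:
  assumes "smooth_on I f" "r \<in> I" shows "(f has_real_derivative dir_deriv 1 f r) (at r)"
proof -
  note f = smooth_on_has_derivative[OF assms]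
  have "dir_deriv v f r = dir_deriv 1 f r * v" for v
    using linear_cmul[OF has_derivative_linear[OF f], of v 1] by simp
  then have "frechet_derivative f (at r) = (*) (dir_deriv 1 f r)" by (rule ext)
  with f show ?thesis by (simp add: has_field_derivative_def)
qed

lemmas k_deriv = smooth_real_has_derivative[OF smooth_k]
  and k1_deriv = smooth_real_has_derivative[OF smooth_on_dir_deriv[OF smooth_k]]
  and h_deriv = smooth_real_has_derivative[OF smooth_h]
  and h1_deriv = smooth_real_has_derivative[OF smooth_on_dir_deriv[OF smooth_h]]

lemma in_I [simp, intro]: "p \<in> D \<Longrightarrow> p $ 1 \<in> I" by blast

lemma open_I: "open I"
proof (rule open_surjective_linear_image[OF open_D])
  show "linear (\<lambda>p::real^2. p $ 1)" by (rule bounded_linear.linear[OF bounded_linear_vec_nth])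
  show "surj (\<lambda>p::real^2. p $ 1)" by (rule surjI[of _ "\<lambda>r. vec r"]) simp
qed

lemma connected_I: "connected I"
  by (intro connected_continuous_image connected_D continuous_intros)

lemma rotation_surface_eq: "\<phi> p = (sphere_part p, h (p $ 1))"
  by (simp add: rotation_surface_def Let_def sphere_part_def pole_def radial_def vec_eq_iff
      forall_3 axis_def)

lemma inner_meridian [simp]:
  "sphere_part p \<bullet> sphere_part p = 1" "meridian p \<bullet> meridian p = 1"
  "sphere_part p \<bullet> meridian p = 0" "meridian p \<bullet> sphere_part p = 0"
  "sphere_part p \<bullet> angular (p $ 2) = 0" "angular (p $ 2) \<bullet> sphere_part p = 0"
  "meridian p \<bullet> angular (p $ 2) = 0" "angular (p $ 2) \<bullet> meridian p = 0"
  by (simp_all add: sphere_part_def meridian_def algebra_simps power2_eq_square[symmetric])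

lemma radial_eq: "radial (p $ 2) = cos (k (p $ 1)) *\<^sub>R sphere_part p - sin (k (p $ 1)) *\<^sub>R meridian p"
  by (simp add: sphere_part_def meridian_def algebra_simps power2_eq_square[symmetric]
      flip: scaleR_add_left)

lemma has_derivative_of_r:
  "p \<in> D \<Longrightarrow> (a has_real_derivative a') (at (p $ 1)) \<Longrightarrow>
    ((\<lambda>q. a (q $ 1)) has_derivative (\<lambda>v. v $ 1 * a')) (at p)"
  by (rule DERIV_compose_FDERIV[OF _ has_derivative_component])

lemma partial_deriv_of_r:
  assumes "p \<in> D" "(a has_real_derivative a') (at (p $ 1))"
  shows "partial_deriv 1 (\<lambda>q. a (q $ 1)) p = a'" "partial_deriv 2 (\<lambda>q. a (q $ 1)) p = 0"
  using partial_derivI[OF has_derivative_of_r[OF assms]] by (simp_all add: axis_def)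

lemma sphere_part_has_derivative:
  assumes "p \<in> D"
  shows "(sphere_part has_derivative
    (\<lambda>v. (v $ 1 * k1 (p $ 1)) *\<^sub>R meridian p + (v $ 2 * cos (k (p $ 1))) *\<^sub>R angular (p $ 2))) (at p)"
  unfolding sphere_part_def[abs_def] meridian_def
  by (auto intro!: derivative_eq_intros has_derivative_component
      has_derivative_of_r[OF assms k_deriv] in_I assms simp: algebra_simps)

lemma meridian_has_derivative:
  assumes "p \<in> D"
  shows "(meridian has_derivative
    (\<lambda>v. - (v $ 1 * k1 (p $ 1)) *\<^sub>R sphere_part p - (v $ 2 * sin (k (p $ 1))) *\<^sub>R angular (p $ 2))) (at p)"
  unfolding sphere_part_def meridian_def[abs_def]
  by (auto intro!: derivative_eq_intros has_derivative_component
      has_derivative_of_r[OF assms k_deriv] in_I assms simp: algebra_simps)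

lemma angular_has_derivative:
  "((\<lambda>q. angular (q $ 2)) has_derivative (\<lambda>v. - (v $ 2) *\<^sub>R radial (p $ 2))) (at p)"
  by (auto intro!: derivative_eq_intros has_derivative_component)

lemma rotation_surface_has_derivative:
  assumes "p \<in> D"
  shows "(\<phi> has_derivative
    (\<lambda>v. ((v $ 1 * k1 (p $ 1)) *\<^sub>R meridian p + (v $ 2 * cos (k (p $ 1))) *\<^sub>R angular (p $ 2),
      v $ 1 * h1 (p $ 1)))) (at p)"
  unfolding rotation_surface_eq[abs_def]
  by (intro has_derivative_Pair sphere_part_has_derivative has_derivative_of_r h_deriv in_I assms)

lemma partial_rotation_surface:
  assumes "p \<in> D"
  shows "partial_deriv 1 \<phi> p = (k1 (p $ 1) *\<^sub>R meridian p, h1 (p $ 1))"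
    and "partial_deriv 2 \<phi> p = (cos (k (p $ 1)) *\<^sub>R angular (p $ 2), 0)"
  using partial_derivI[OF rotation_surface_has_derivative[OF assms]] by (simp_all add: axis_def)

lemma second_partial_rotation_surface:
  assumes "p \<in> D"
  shows "partial_deriv 1 (partial_deriv 1 \<phi>) p =
      (k2 (p $ 1) *\<^sub>R meridian p - (k1 (p $ 1))\<^sup>2 *\<^sub>R sphere_part p, h2 (p $ 1))"
    and "partial_deriv 2 (partial_deriv 2 \<phi>) p = (- cos (k (p $ 1)) *\<^sub>R radial (p $ 2), 0)"
proof -
  have "partial_deriv 1 (partial_deriv 1 \<phi>) p =
      partial_deriv 1 (\<lambda>q. (k1 (q $ 1) *\<^sub>R meridian q, h1 (q $ 1))) p"
    by (rule partial_deriv_cong[OF open_D assms]) (rule partial_rotation_surface)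
  also have "\<dots> = (k2 (p $ 1) *\<^sub>R meridian p - (k1 (p $ 1))\<^sup>2 *\<^sub>R sphere_part p, h2 (p $ 1))"
    by (simp add: axis_def power2_eq_square
        partial_derivI[OF has_derivative_Pair[OF has_derivative_scaleR[OF
          has_derivative_of_r[OF assms k1_deriv[OF in_I[OF assms]]] meridian_has_derivative[OF assms]]
          has_derivative_of_r[OF assms h1_deriv[OF in_I[OF assms]]]]])
  finally show "partial_deriv 1 (partial_deriv 1 \<phi>) p = \<dots>" .
  have "partial_deriv 2 (partial_deriv 2 \<phi>) p =
      partial_deriv 2 (\<lambda>q. (cos (k (q $ 1)) *\<^sub>R angular (q $ 2), 0)) p"
    by (rule partial_deriv_cong[OF open_D assms]) (rule partial_rotation_surface)
  also have "\<dots> = (- cos (k (p $ 1)) *\<^sub>R radial (p $ 2), 0)"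
    by (simp add: axis_def
        partial_derivI[OF has_derivative_Pair[OF has_derivative_scaleR[OF
          has_derivative_cos[OF has_derivative_of_r[OF assms k_deriv[OF in_I[OF assms]]]]
          angular_has_derivative] has_derivative_const]])
  finally show "partial_deriv 2 (partial_deriv 2 \<phi>) p = \<dots>" .
qed

text \<open>The induced metric is \<open>E dr\<^sup>2 + G d\<theta>\<^sup>2\<close>; the primed functions are the derivatives of \<open>E\<close> and \<open>G\<close>.\<close>

definition "E r = (k1 r)\<^sup>2 + (h1 r)\<^sup>2"
definition "G r = (cos (k r))\<^sup>2"
definition "E' r = 2 * k1 r * k2 r + 2 * h1 r * h2 r"
definition "G' r = - 2 * cos (k r) * sin (k r) * k1 r"

lemma metric_eq:
  assumes "p \<in> D"
  shows "g p $ 1 $ 1 = E (p $ 1)" "g p $ 1 $ 2 = 0" "g p $ 2 $ 1 = 0" "g p $ 2 $ 2 = G (p $ 1)"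
  by (simp_all add: induced_metric_def partial_rotation_surface[OF assms] E_def G_def
      power2_eq_square)

lemma E_pos: "r \<in> I \<Longrightarrow> 0 < E r" and cos_k_nonzero: "r \<in> I \<Longrightarrow> cos (k r) \<noteq> 0"
proof -
  have *: "partial_deriv i \<phi> p \<noteq> 0" if "p \<in> D" for i p
  proof -
    have "linear (frechet_derivative \<phi> (at p))"
      by (rule linear_frechet_derivative)
         (use rotation_surface_has_derivative[OF that] in \<open>auto simp: differentiable_def\<close>)
    moreover have "inj (frechet_derivative \<phi> (at p))"
      using immersed that by (simp add: immersed_surface_def)
    ultimately have "\<forall>v. frechet_derivative \<phi> (at p) v = 0 \<longrightarrow> v = 0"
      by (simp add: linear_injective_0)
    moreover have "axis i (1::real) \<noteq> 0" by (simp add: axis_eq_0_iff)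
    ultimately show ?thesis unfolding partial_deriv_def by blast
  qed
  show "0 < E r" if r: "r \<in> I"
  proof -
    obtain p where p: "p \<in> D" "r = p $ 1" using r by auto
    have "k1 r \<noteq> 0 \<or> h1 r \<noteq> 0"
      using *[OF p(1), of 1] by (auto simp: partial_rotation_surface[OF p(1)] p(2) zero_prod_def)
    then show ?thesis unfolding E_def by (metis sum_power2_gt_zero_iff)
  qed
  show "cos (k r) \<noteq> 0" if r: "r \<in> I"
  proof -
    obtain p where p: "p \<in> D" "r = p $ 1" using r by auto
    show ?thesis
      using *[OF p(1), of 2] by (auto simp: partial_rotation_surface[OF p(1)] p(2) zero_prod_def)
  qed
qed

lemma G_pos: "r \<in> I \<Longrightarrow> 0 < G r"
  using cos_k_nonzero by (simp add: G_def)

lemma E_deriv: "r \<in> I \<Longrightarrow> (E has_real_derivative E' r) (at r)"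
  unfolding E_def[abs_def] E'_def
  by (auto intro!: derivative_eq_intros k1_deriv h1_deriv simp: algebra_simps)

lemma G_deriv: "r \<in> I \<Longrightarrow> (G has_real_derivative G' r) (at r)"
  unfolding G_def[abs_def] G'_def
  by (auto intro!: derivative_eq_intros k_deriv simp: algebra_simps)

lemma inverse_metric_eq:
  assumes "p \<in> D"
  shows "inverse_metric g p $ 1 $ 1 = 1 / E (p $ 1)" "inverse_metric g p $ 1 $ 2 = 0"
    "inverse_metric g p $ 2 $ 1 = 0" "inverse_metric g p $ 2 $ 2 = 1 / G (p $ 1)"
  using E_pos[OF in_I[OF assms]] G_pos[OF in_I[OF assms]]
  by (simp_all add: inverse_metric_def matrix_inv_diagonal_2 metric_eq[OF assms])

lemma partial_metric:
  assumes "p \<in> D"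
  shows "partial_deriv 1 (\<lambda>q. g q $ 1 $ 1) p = E' (p $ 1)" "partial_deriv 2 (\<lambda>q. g q $ 1 $ 1) p = 0"
    "partial_deriv 1 (\<lambda>q. g q $ 2 $ 2) p = G' (p $ 1)" "partial_deriv 2 (\<lambda>q. g q $ 2 $ 2) p = 0"
    "partial_deriv i (\<lambda>q. g q $ 1 $ 2) p = 0" "partial_deriv i (\<lambda>q. g q $ 2 $ 1) p = 0"
proof -
  have const: "partial_deriv i (\<lambda>q. 0::real) p = 0" for i
    using partial_derivI[OF has_derivative_const] by blast
  have cong: "partial_deriv i (\<lambda>q. g q $ j $ l) p = partial_deriv i u p"
    if "\<And>q. q \<in> D \<Longrightarrow> g q $ j $ l = u q" for i j l u
    by (rule partial_deriv_cong[OF open_D assms that])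
  show "partial_deriv 1 (\<lambda>q. g q $ 1 $ 1) p = E' (p $ 1)" "partial_deriv 2 (\<lambda>q. g q $ 1 $ 1) p = 0"
    "partial_deriv 1 (\<lambda>q. g q $ 2 $ 2) p = G' (p $ 1)" "partial_deriv 2 (\<lambda>q. g q $ 2 $ 2) p = 0"
    "partial_deriv i (\<lambda>q. g q $ 1 $ 2) p = 0" "partial_deriv i (\<lambda>q. g q $ 2 $ 1) p = 0"
    using partial_deriv_of_r[OF assms E_deriv[OF in_I[OF assms]]]
      partial_deriv_of_r[OF assms G_deriv[OF in_I[OF assms]]]
    by (simp_all add: cong[OF metric_eq(1)] cong[OF metric_eq(2)] cong[OF metric_eq(3)]
        cong[OF metric_eq(4)] const)
qed

lemma christoffel_eq:
  assumes "p \<in> D"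
  shows "christoffel g 1 1 1 p = E' (p $ 1) / (2 * E (p $ 1))"
    "christoffel g 2 1 1 p = 0"
    "christoffel g 1 2 2 p = - G' (p $ 1) / (2 * E (p $ 1))"
    "christoffel g 2 2 2 p = 0"
  by (simp_all add: christoffel_def sum_2 inverse_metric_eq[OF assms] partial_metric[OF assms])

text \<open>The Christoffel symbols contribute a single first-order term \<open>drift \<partial>\<^sub>r\<close> to the Laplacian of the induced metric.\<close>

definition "drift r = - E' r / (2 * (E r)\<^sup>2) + G' r / (2 * E r * G r)"

definition lap :: "(real^2 \<Rightarrow> 'c::real_normed_vector) \<Rightarrow> real^2 \<Rightarrow> 'c" where
  "lap u p = (1 / E (p $ 1)) *\<^sub>R partial_deriv 1 (partial_deriv 1 u) p
    + (1 / G (p $ 1)) *\<^sub>R partial_deriv 2 (partial_deriv 2 u) p + drift (p $ 1) *\<^sub>R partial_deriv 1 u p"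

lemma metric_trace_eq:
  "p \<in> D \<Longrightarrow> metric_trace g B p = (1 / E (p $ 1)) *\<^sub>R B 1 1 + (1 / G (p $ 1)) *\<^sub>R B 2 2"
  by (simp add: metric_trace_def sum_2 inverse_metric_eq)

lemma drift_eq:
  assumes "p \<in> D"
  shows "drift (p $ 1) = - (christoffel g 1 1 1 p / E (p $ 1)) - christoffel g 1 2 2 p / G (p $ 1)"
  using E_pos[OF in_I[OF assms]] G_pos[OF in_I[OF assms]]
  by (simp add: christoffel_eq[OF assms] drift_def field_simps power2_eq_square)

lemma laplacian_eq: "p \<in> D \<Longrightarrow> laplacian g u p = lap u p"
  by (simp add: laplacian_def metric_trace_eq hessian_def sum_2 christoffel_eq(2,4) lap_def drift_eq
      diff_divide_distrib algebra_simps)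

text \<open>The covariant derivative projects second derivatives onto the tangent space of \<open>S\<^sup>2 \<times> \<real>\<close>, so the correction that turns
  \<open>lap u\<close> into the tension field involves the second-order terms alone.\<close>

definition trace_hess :: "(real^2 \<Rightarrow> ambient) \<Rightarrow> real^2 \<Rightarrow> real^3" where
  "trace_hess u p = (1 / E (p $ 1)) *\<^sub>R fst (partial_deriv 1 (partial_deriv 1 u) p)
    + (1 / G (p $ 1)) *\<^sub>R fst (partial_deriv 2 (partial_deriv 2 u) p)"

lemma tension_field_eq:
  assumes "p \<in> D"
  shows "tension_field g u p = lap u p - ((trace_hess u p \<bullet> fst (u p)) *\<^sub>R fst (u p), 0)"
  by (simp add: tension_field_def metric_trace_eq[OF assms] nabla_d_def sum_2 christoffel_eq(2,4)[OF assms]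
      cov_deriv_def tangent_proj_def lap_def trace_hess_def drift_eq[OF assms] prod_eq_iff
      scaleR_diff_right scaleR_diff_left inner_add_left scaleR_add_left)

end

section \<open>Harmonic profile\<close>

locale harmonic_rotation_patch = rotation_patch +
  assumes harmonic: "\<forall>p\<in>D. laplacian g (\<lambda>q. k (q $ 1)) p = 0"
begin

text \<open>In divergence form, \<open>\<sigma> \<Delta>u = (A u\<^sub>r)\<^sub>r + (\<sigma>/G) u\<^sub>\<theta>\<^sub>\<theta>\<close> with the area density \<open>\<sigma>\<close>. The tension field of the surface will
  be \<open>(tan_k N, height_tension)\<close>, where \<open>height_tension\<close> is \<open>\<Delta>h\<close>, and \<open>\<rho>\<close> is the \<open>N\<close>-component of the
  Euler-Lagrange operator of the bienergy at the surface.\<close>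

definition "A r = sqrt (G r / E r)"
definition "\<sigma> r = sqrt (E r * G r)"
definition "tan_k r = tan (k r)"
definition "height_tension r = h2 r / E r + drift r * h1 r"
definition "\<rho> r = tan_k r * (2 * ((k1 r)\<^sup>2 / E r) * (1 + (tan_k r)\<^sup>2) + 1 - (tan_k r)\<^sup>2)"

lemma harmonic_eq:
  assumes "r \<in> I" shows "k2 r / E r + drift r * k1 r = 0"
proof -
  obtain p where p: "p \<in> D" "r = p $ 1" using assms by auto
  let ?u = "\<lambda>q. k (q $ 1)"
  have first: "partial_deriv 1 ?u q = k1 (q $ 1)" "partial_deriv 2 ?u q = 0" if "q \<in> D" for q
    using partial_deriv_of_r[OF that k_deriv[OF in_I[OF that]]] by auto
  have "partial_deriv 1 (partial_deriv 1 ?u) p = partial_deriv 1 (\<lambda>q. k1 (q $ 1)) p"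
    by (rule partial_deriv_cong[OF open_D p(1) first(1)])
  also have "\<dots> = k2 (p $ 1)" by (rule partial_deriv_of_r[OF p(1) k1_deriv[OF in_I[OF p(1)]]])
  finally have 1: "partial_deriv 1 (partial_deriv 1 ?u) p = k2 (p $ 1)" .
  have "partial_deriv 2 (partial_deriv 2 ?u) p = partial_deriv 2 (\<lambda>q. 0) p"
    by (rule partial_deriv_cong[OF open_D p(1) first(2)])
  also have "\<dots> = (0::real)" using partial_derivI[OF has_derivative_const] by blast
  finally have 2: "partial_deriv 2 (partial_deriv 2 ?u) p = 0" .
  have "lap ?u p = 0" using harmonic p(1) laplacian_eq[OF p(1), of ?u] by simp
  then show ?thesis by (simp add: lap_def 1 2 first[OF p(1)] p(2))
qed

lemma A_pos: "r \<in> I \<Longrightarrow> 0 < A r"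
  by (simp add: A_def E_pos G_pos)

lemma \<sigma>_eq: "r \<in> I \<Longrightarrow> \<sigma> r = A r * E r"
  using E_pos[of r] G_pos[of r] by (simp add: \<sigma>_def A_def real_sqrt_mult real_sqrt_divide field_simps)

lemma \<sigma>_pos: "r \<in> I \<Longrightarrow> 0 < \<sigma> r"
  by (simp add: \<sigma>_eq A_pos E_pos)

lemma A_deriv:
  assumes r: "r \<in> I" shows "(A has_real_derivative \<sigma> r * drift r) (at r)"
proof -
  have pos: "0 < E r" "0 < G r" "0 < A r" using r E_pos G_pos A_pos by auto
  have "((\<lambda>r. G r / E r) has_real_derivative (G' r * E r - G r * E' r) / (E r * E r)) (at r)"
    by (rule DERIV_divide[OF G_deriv[OF r] E_deriv[OF r]]) (use pos in simp)
  from DERIV_chain2[OF DERIV_real_sqrt this]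
  have "(A has_real_derivative inverse (A r) / 2 * ((G' r * E r - G r * E' r) / (E r * E r))) (at r)"
    using pos by (simp add: A_def[abs_def])
  moreover have "inverse (A r) = A r * E r / G r"
  proof -
    have "A r * A r = G r / E r" using pos by (simp add: A_def)
    then show ?thesis using pos by (simp add: field_simps)
  qed
  moreover have "A r * E r / G r / 2 * ((G' r * E r - G r * E' r) / (E r * E r)) = \<sigma> r * drift r"
    using pos by (simp add: \<sigma>_eq[OF r] drift_def field_simps power2_eq_square)
  ultimately show ?thesis by simp
qed

text \<open>This integrates \<open>\<Delta>k = 0\<close> once: \<open>(A k')' = \<sigma> \<Delta>k\<close>.\<close>

lemma flux_constant: "\<exists>c. \<forall>r\<in>I. A r * k1 r = c"
proof -
  have "((\<lambda>r. A r * k1 r) has_real_derivative 0) (at r)" if r: "r \<in> I" for r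
  proof (rule DERIV_cong[OF DERIV_mult[OF A_deriv[OF r] k1_deriv[OF r]]])
    have "\<sigma> r * drift r * k1 r + k2 r * A r = \<sigma> r * (k2 r / E r + drift r * k1 r)"
      using E_pos[OF r] by (simp add: \<sigma>_eq[OF r] field_simps)
    then show "\<sigma> r * drift r * k1 r + k2 r * A r = 0" by (simp add: harmonic_eq[OF r])
  qed
  from has_field_derivative_0_imp_constant_on[OF this connected_I open_I]
  show ?thesis by (simp add: constant_on_def)
qed

lemma tan_k_deriv:
  assumes "r \<in> I" shows "(tan_k has_real_derivative k1 r * (1 + (tan_k r)\<^sup>2)) (at r)"
  unfolding tan_k_def[abs_def]
  by (rule DERIV_cong[OF DERIV_chain2[OF DERIV_tan k_deriv[OF assms]]])
     (use cos_k_nonzero[OF assms] in \<open>auto simp: tan_def power2_eq_square field_simps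
       simp flip: distrib_left cos_squared_eq\<close>)

lemma sin_k_eq: "r \<in> I \<Longrightarrow> sin (k r) = tan_k r * cos (k r)"
  using cos_k_nonzero by (simp add: tan_k_def tan_def)

lemma trace_hess_rotation_surface:
  assumes "p \<in> D"
  shows "trace_hess \<phi> p \<bullet> sphere_part p = - ((k1 (p $ 1))\<^sup>2 / E (p $ 1)) - 1"
  using cos_k_nonzero[OF in_I[OF assms]]
  by (simp add: trace_hess_def second_partial_rotation_surface[OF assms] radial_eq inner_add_left
      inner_diff_left G_def power2_eq_square)

text \<open>The \<open>N\<close>-component of the tension field is \<open>\<Delta>k + tan k\<close>; the second summand is the geodesic curvature of the parallels.\<close>

lemma tension_rotation_surface:
  assumes p: "p \<in> D"
  shows "tension_field g \<phi> p = (tan_k (p $ 1) *\<^sub>R meridian p, height_tension (p $ 1))"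
proof (rule prod_eqI)
  let ?r = "p $ 1"
  have G: "G ?r = cos (k ?r) * cos (k ?r)" "cos (k ?r) \<noteq> 0"
    using cos_k_nonzero[OF in_I[OF p]] by (simp_all add: G_def power2_eq_square)
  have X: "fst (\<phi> p) = sphere_part p" by (simp add: rotation_surface_eq)
  have "fst (lap \<phi> p) = (k2 ?r / E ?r + drift ?r * k1 ?r) *\<^sub>R meridian p
      - ((k1 ?r)\<^sup>2 / E ?r) *\<^sub>R sphere_part p - (cos (k ?r) / G ?r) *\<^sub>R radial (p $ 2)"
    by (simp add: lap_def second_partial_rotation_surface[OF p] partial_rotation_surface[OF p]
        scaleR_diff_right scaleR_add_left)
  also have "\<dots> = tan_k ?r *\<^sub>R meridian p + (- ((k1 ?r)\<^sup>2 / E ?r) - 1) *\<^sub>R sphere_part p"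
    using G(2) by (simp add: harmonic_eq[OF in_I[OF p]] radial_eq scaleR_diff_right scaleR_diff_left
        G(1) sin_k_eq[OF in_I[OF p]])
  finally show "fst (tension_field g \<phi> p) = fst (tan_k ?r *\<^sub>R meridian p, height_tension ?r)"
    by (simp add: tension_field_eq[OF p] trace_hess_rotation_surface[OF p] X)
  show "snd (tension_field g \<phi> p) = snd (tan_k ?r *\<^sub>R meridian p, height_tension ?r)"
    by (simp add: tension_field_eq[OF p] lap_def second_partial_rotation_surface[OF p]
        partial_rotation_surface[OF p] height_tension_def)
qed

text \<open>The tension field of an isometric immersion is normal; this is its inner product with \<open>f\<^sub>r\<close>, computed from
  \<open>k' \<Delta>k + h' \<Delta>h = E'/(2 E) + drift E\<close>.\<close>

lemma tension_normal:
  assumes r: "r \<in> I" shows "k1 r * tan_k r + h1 r * height_tension r = 0"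
proof -
  have pos: "E r \<noteq> 0" "cos (k r) \<noteq> 0" using E_pos[OF r] cos_k_nonzero[OF r] by auto
  have "k1 r * (k2 r / E r + drift r * k1 r) + h1 r * height_tension r =
      (k1 r * k2 r + h1 r * h2 r) / E r + drift r * ((k1 r)\<^sup>2 + (h1 r)\<^sup>2)"
    by (simp add: height_tension_def algebra_simps add_divide_distrib power2_eq_square)
  also have "\<dots> = E' r / (2 * E r) + drift r * E r"
    by (simp add: E_def[symmetric]) (simp add: E'_def add_divide_distrib)
  also have "\<dots> = G' r / (2 * G r)"
    using pos G_pos[OF r] by (simp add: drift_def field_simps power2_eq_square)
  also have "\<dots> = - k1 r * tan_k r"
    using pos by (simp add: G'_def G_def sin_k_eq[OF r] power2_eq_square)
  finally show ?thesis by (simp add: harmonic_eq[OF r])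
qed

lemma continuous_coefficients:
  "continuous_on I k1" "continuous_on I E" "continuous_on I G" "continuous_on I drift"
  "continuous_on I \<sigma>" "continuous_on I tan_k" "continuous_on I A"
proof -
  have diff: "continuous_on I f" if "\<And>r. r \<in> I \<Longrightarrow> (f has_real_derivative f' r) (at r)" for f f'
    by (rule continuous_at_imp_continuous_on, rule ballI, rule DERIV_isCont, rule that)
  have smooth: "continuous_on I k1" "continuous_on I k2" "continuous_on I h1" "continuous_on I h2" "continuous_on I k"
    by (intro smooth_on_continuous smooth_on_dir_deriv smooth_k smooth_h)+
  show E: "continuous_on I E" and G: "continuous_on I G" and "continuous_on I tan_k" and "continuous_on I A"
    using diff[OF E_deriv] diff[OF G_deriv] diff[OF tan_k_deriv] diff[OF A_deriv] by blast+
  show "continuous_on I k1" by (rule smooth)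
  show "continuous_on I \<sigma>" unfolding \<sigma>_def[abs_def] by (intro continuous_intros E G)
  have "E r \<noteq> 0" "G r \<noteq> 0" if "r \<in> I" for r using E_pos[OF that] G_pos[OF that] by auto
  then show "continuous_on I drift"
    unfolding drift_def[abs_def] E'_def[abs_def] G'_def[abs_def] by (intro continuous_intros E G smooth) auto
qed

end

section \<open>Green's formula for the tension field\<close>

lemma smooth_on_partial_deriv: "smooth_on S u \<Longrightarrow> smooth_on S (partial_deriv i u)"
  unfolding partial_deriv_def[abs_def] by (rule smooth_on_dir_deriv)

lemma partial_deriv_const: "partial_deriv i (\<lambda>_. c) p = 0"
  using partial_derivI[OF has_derivative_const] .

lemma axis_simps:
  "axis 1 (1::real) $ (1::2) = 1" "axis 1 (1::real) $ (2::2) = 0"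
  "axis 2 (1::real) $ (1::2) = 0" "axis 2 (1::real) $ (2::2) = 1"
  by (simp_all add: axis_def)

context harmonic_rotation_patch
begin

lemma continuous_sphere_part: "continuous_on D sphere_part"
  and continuous_meridian: "continuous_on D meridian"
  by (auto intro!: continuous_at_imp_continuous_on has_derivative_continuous
      dest: sphere_part_has_derivative meridian_has_derivative)

lemma continuous_on_of_r: "continuous_on I a \<Longrightarrow> continuous_on D (\<lambda>p. a (p $ 1))"
  by (rule continuous_on_compose2[of I a D "\<lambda>p. p $ 1"]) (simp_all add: continuous_on_component)

lemma tangential_partial:
  assumes V: "smooth_on D V" and tang: "\<And>p. p \<in> D \<Longrightarrow> fst (V p) \<bullet> sphere_part p = 0"
    and p: "p \<in> D"
  shows "fst (partial_deriv 1 V p) \<bullet> sphere_part p = - k1 (p $ 1) * (fst (V p) \<bullet> meridian p)"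
proof -
  have "partial_deriv 1 (\<lambda>q. fst (V q) \<bullet> sphere_part q) p = partial_deriv 1 (\<lambda>_. 0) p"
    by (rule partial_deriv_cong[OF open_D p tang])
  then have "partial_deriv 1 (\<lambda>q. fst (V q) \<bullet> sphere_part q) p = 0"
    by (simp add: partial_deriv_const)
  with partial_derivI[OF has_derivative_inner[OF has_derivative_fst[OF smooth_on_has_derivative[OF V p]]
        sphere_part_has_derivative[OF p]], of 1]
  show ?thesis by (simp add: axis_def partial_deriv_def algebra_simps)
qed

text \<open>Green's formula for \<open>V\<close> and \<open>tan_k N\<close>. The field under the divergence has the components
  \<open>A (\<langle>V\<^sub>r, tan_k N\<rangle> - \<langle>V, (tan_k N)\<^sub>r\<rangle>)\<close> and \<open>(\<sigma>/G) (\<langle>V\<^sub>\<theta>, tan_k N\<rangle> - \<langle>V, (tan_k N)\<^sub>\<theta>\<rangle>)\<close>, called \<open>Z1\<close> and \<open>Z2\<close>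
  below. Since \<open>V\<close> is tangent to the sphere and \<open>A k' = c\<close>, the first is
  \<open>A tan_k \<langle>V\<^sub>r, N\<rangle> - c (1 + tan_k\<^sup>2) \<langle>V, N\<rangle>\<close>, whose derivative contains no derivative of \<open>k\<close> of order three.\<close>

lemma integral_by_parts:
  fixes V :: "real^2 \<Rightarrow> ambient"
  assumes K: "compact K" "K \<subseteq> D" and V: "smooth_on D V"
    and supp: "\<And>p. p \<in> D - K \<Longrightarrow> V p = 0"
    and tang: "\<And>p. p \<in> D \<Longrightarrow> fst (V p) \<bullet> sphere_part p = 0"
  defines "J \<equiv> \<lambda>p. \<sigma> (p $ 1) * (tan_k (p $ 1) * (fst (lap V p) \<bullet> meridian p)
    + (((k1 (p $ 1))\<^sup>2 / E (p $ 1) + 1) * tan_k (p $ 1) - \<rho> (p $ 1)) * (fst (V p) \<bullet> meridian p))"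
  shows "(LINT p:K|lborel. J p) = 0" and "set_integrable lborel K J"
proof -
  obtain c where c: "\<And>r. r \<in> I \<Longrightarrow> A r * k1 r = c" using flux_constant by blast
  let ?V1 = "partial_deriv 1 V" and ?V2 = "partial_deriv 2 V"
  let ?V11 = "partial_deriv 1 ?V1" and ?V22 = "partial_deriv 2 ?V2"
  define a1 where "a1 r = A r * tan_k r" for r
  define a1' where "a1' r = \<sigma> r * drift r * tan_k r + c * (1 + (tan_k r)\<^sup>2)" for r
  define a2 where "a2 r = c * (1 + (tan_k r)\<^sup>2)" for r
  define a2' where "a2' r = 2 * c * tan_k r * (k1 r * (1 + (tan_k r)\<^sup>2))" for r
  define a3 where "a3 r = \<sigma> r / G r * tan_k r" for r
  define Z1 where "Z1 p = a1 (p $ 1) * (fst (?V1 p) \<bullet> meridian p) - a2 (p $ 1) * (fst (V p) \<bullet> meridian p)" for p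
  define Z1' where "Z1' p = a1 (p $ 1) * (fst (?V11 p) \<bullet> meridian p - k1 (p $ 1) * (fst (?V1 p) \<bullet> sphere_part p))
      + a1' (p $ 1) * (fst (?V1 p) \<bullet> meridian p)
      - a2 (p $ 1) * (fst (?V1 p) \<bullet> meridian p - k1 (p $ 1) * (fst (V p) \<bullet> sphere_part p))
      - a2' (p $ 1) * (fst (V p) \<bullet> meridian p)" for p
  define Z2 where "Z2 p = a3 (p $ 1) *
      (fst (?V2 p) \<bullet> meridian p + sin (k (p $ 1)) * (fst (V p) \<bullet> angular (p $ 2)))" for p
  define Z2' where "Z2' p = a3 (p $ 1) *
      (fst (?V22 p) \<bullet> meridian p - sin (k (p $ 1)) * (fst (V p) \<bullet> radial (p $ 2)))" for p
  note V1 = smooth_on_partial_deriv[OF V, of 1] and V2 = smooth_on_partial_deriv[OF V, of 2]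
  note V11 = smooth_on_partial_deriv[OF V1, of 1] and V22 = smooth_on_partial_deriv[OF V2, of 2]
  note dfst = has_derivative_fst[OF smooth_on_has_derivative]
  have a1: "(a1 has_real_derivative a1' r) (at r)" if "r \<in> I" for r
    unfolding a1_def[abs_def] a1'_def
    by (rule DERIV_cong[OF DERIV_mult[OF A_deriv[OF that] tan_k_deriv[OF that]]])
       (simp add: c[OF that, symmetric] algebra_simps)
  have a2: "(a2 has_real_derivative a2' r) (at r)" if "r \<in> I" for r
    unfolding a2_def[abs_def] a2'_def
    by (auto intro!: derivative_eq_intros tan_k_deriv[OF that])
  have Z1: "(Z1 has_derivative (\<lambda>v.
      (a1 (p $ 1) * (fst (?V1 p) \<bullet> (- (v $ 1 * k1 (p $ 1)) *\<^sub>R sphere_part p - (v $ 2 * sin (k (p $ 1))) *\<^sub>R angular (p $ 2))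
          + fst (frechet_derivative ?V1 (at p) v) \<bullet> meridian p)
        + v $ 1 * a1' (p $ 1) * (fst (?V1 p) \<bullet> meridian p))
      - (a2 (p $ 1) * (fst (V p) \<bullet> (- (v $ 1 * k1 (p $ 1)) *\<^sub>R sphere_part p - (v $ 2 * sin (k (p $ 1))) *\<^sub>R angular (p $ 2))
          + fst (frechet_derivative V (at p) v) \<bullet> meridian p)
        + v $ 1 * a2' (p $ 1) * (fst (V p) \<bullet> meridian p)))) (at p)" if p: "p \<in> D" for p
    unfolding Z1_def[abs_def]
    by (intro has_derivative_diff has_derivative_mult has_derivative_inner dfst[OF V1 p] dfst[OF V p]
        meridian_has_derivative[OF p] has_derivative_of_r[OF p a1] has_derivative_of_r[OF p a2] in_I p)
  have Z1_line: "((\<lambda>s. Z1 (p + s *\<^sub>R axis 1 1)) has_real_derivative Z1' p) (at 0)" if p: "p \<in> D" for p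
    using has_vector_derivative_along_line[of Z1 _ p 0 "axis 1 1", unfolded scaleR_zero_left add_0_right, OF Z1[OF p]]
    by (simp add: has_real_derivative_iff_has_vector_derivative Z1'_def partial_deriv_def[symmetric] axis_simps
        algebra_simps)
  (* Z2 is differentiated in the direction of \<theta> only, where a3 is constant, so differentiability of a3 is what counts *)
  have a3: "(a3 has_real_derivative deriv a3 r) (at r)" if r: "r \<in> I" for r
  proof -
    have "((\<lambda>r. A r * E r / G r * tan_k r) has_real_derivative
        ((\<sigma> r * drift r * E r + E' r * A r) * G r - A r * E r * G' r) / (G r * G r) * tan_k r
          + k1 r * (1 + (tan_k r)\<^sup>2) * (A r * E r / G r)) (at r)"
      using G_pos[OF r]
      by (intro DERIV_mult DERIV_divide A_deriv E_deriv G_deriv tan_k_deriv r) auto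
    then have "(a3 has_real_derivative
        ((\<sigma> r * drift r * E r + E' r * A r) * G r - A r * E r * G' r) / (G r * G r) * tan_k r
          + k1 r * (1 + (tan_k r)\<^sup>2) * (A r * E r / G r)) (at r)"
      by (rule has_field_derivative_transform_within_open[OF _ open_I r]) (simp add: a3_def \<sigma>_eq)
    then show ?thesis using DERIV_imp_deriv by metis
  qed
  have Z2: "(Z2 has_derivative (\<lambda>v.
      a3 (p $ 1) * ((fst (?V2 p) \<bullet> (- (v $ 1 * k1 (p $ 1)) *\<^sub>R sphere_part p - (v $ 2 * sin (k (p $ 1))) *\<^sub>R angular (p $ 2))
          + fst (frechet_derivative ?V2 (at p) v) \<bullet> meridian p)
        + (sin (k (p $ 1)) * (fst (V p) \<bullet> (- (v $ 2) *\<^sub>R radial (p $ 2)) + fst (frechet_derivative V (at p) v) \<bullet> angular (p $ 2))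
          + (v $ 1 * k1 (p $ 1)) * cos (k (p $ 1)) * (fst (V p) \<bullet> angular (p $ 2))))
      + v $ 1 * deriv a3 (p $ 1) *
          (fst (?V2 p) \<bullet> meridian p + sin (k (p $ 1)) * (fst (V p) \<bullet> angular (p $ 2))))) (at p)" if p: "p \<in> D" for p
    unfolding Z2_def[abs_def]
    by (intro has_derivative_add has_derivative_mult has_derivative_inner dfst[OF V2 p] dfst[OF V p]
        meridian_has_derivative[OF p] angular_has_derivative has_derivative_of_r[OF p a3] in_I p
        has_derivative_sin has_derivative_of_r[OF p k_deriv])
  have Z2_line: "((\<lambda>s. Z2 (p + s *\<^sub>R axis 2 1)) has_real_derivative Z2' p) (at 0)" if p: "p \<in> D" for p
    using has_vector_derivative_along_line[of Z2 _ p 0 "axis 2 1", unfolded scaleR_zero_left add_0_right, OF Z2[OF p]]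
    by (simp add: has_real_derivative_iff_has_vector_derivative Z2'_def partial_deriv_def[symmetric] axis_simps
        algebra_simps)
  have contV: "continuous_on D V" "continuous_on D ?V1" "continuous_on D ?V2"
    "continuous_on D ?V11" "continuous_on D ?V22"
    by (intro smooth_on_continuous V V1 V2 V11 V22)+
  have contk: "continuous_on I k" by (rule smooth_on_continuous[OF smooth_k])
  have G0: "G r \<noteq> 0" if "r \<in> I" for r using G_pos[OF that] by simp
  have conta: "continuous_on I a1" "continuous_on I a1'" "continuous_on I a2" "continuous_on I a2'" "continuous_on I a3"
    unfolding a1_def[abs_def] a1'_def[abs_def] a2_def[abs_def] a2'_def[abs_def] a3_def[abs_def]
    by (intro continuous_intros continuous_coefficients ballI G0; assumption)+
  have cont_frame: "continuous_on D (\<lambda>p. radial (p $ 2))" "continuous_on D (\<lambda>p. angular (p $ 2))"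
    unfolding radial_def angular_def by (intro continuous_intros)+
  note cont = continuous_on_inner continuous_on_mult continuous_on_add continuous_on_diff continuous_on_fst
    continuous_on_sin continuous_on_of_r continuous_meridian continuous_sphere_part contV contk conta
    cont_frame continuous_coefficients(1)
  have contZ: "continuous_on D Z1" "continuous_on D Z1'" "continuous_on D Z2" "continuous_on D Z2'"
    unfolding Z1_def[abs_def] Z1'_def[abs_def] Z2_def[abs_def] Z2'_def[abs_def] by (intro cont)+
  have "open (D - K)" using open_D K by (simp add: compact_imp_closed open_Diff)
  then have supp': "partial_deriv i V p = 0" if "p \<in> D - K" for i p
    using partial_deriv_cong[of "D - K" p V "\<lambda>_. 0" i] supp that by (simp add: partial_deriv_const)
  have Z1_int: "(LINT p:K|lborel. Z1' p) = 0"
    by (rule set_integral_directional_derivative_eq_0[OF open_D K _ contZ(1,2) Z1_line])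
       (simp_all add: Z1_def supp supp')
  have Z2_int: "(LINT p:K|lborel. Z2' p) = 0"
    by (rule set_integral_directional_derivative_eq_0[OF open_D K _ contZ(3,4) Z2_line])
       (simp_all add: Z2_def supp supp')
  have J: "J p = Z1' p + Z2' p" if p: "p \<in> D" for p
  proof -
    let ?r = "p $ 1"
    have rI: "?r \<in> I" using p by blast
    define v where "v = fst (V p) \<bullet> meridian p"
    define v1 where "v1 = fst (?V1 p) \<bullet> meridian p"
    define v11 where "v11 = fst (?V11 p) \<bullet> meridian p"
    define v22 where "v22 = fst (?V22 p) \<bullet> meridian p"
    have lapV: "fst (lap V p) \<bullet> meridian p = v11 / E ?r + v22 / G ?r + drift ?r * v1"
      by (simp add: lap_def inner_add_left v1_def v11_def v22_def)
    have rad: "fst (V p) \<bullet> radial (p $ 2) = - (tan_k ?r * cos (k ?r)) * v"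
      by (simp add: radial_eq inner_diff_right tang[OF p] v_def sin_k_eq[OF rI])
    have nz: "E ?r \<noteq> 0" "cos (k ?r) \<noteq> 0" using E_pos[OF rI] cos_k_nonzero[OF rI] by auto
    have Z1p: "Z1' p = A ?r * tan_k ?r * (v11 + (k1 ?r)\<^sup>2 * v) + A ?r * E ?r * drift ?r * tan_k ?r * v1
        - 2 * (A ?r * k1 ?r) * tan_k ?r * (k1 ?r * (1 + (tan_k ?r)\<^sup>2)) * v"
      unfolding Z1'_def a1_def a1'_def a2_def a2'_def
      by (simp add: tangential_partial[OF V tang p] tang[OF p] c[OF rI] \<sigma>_eq[OF rI]
          power2_eq_square algebra_simps flip: v_def v1_def v11_def)
    have Z2p: "Z2' p = A ?r * E ?r / G ?r * tan_k ?r * (v22 + (tan_k ?r * cos (k ?r))\<^sup>2 * v)"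
      unfolding Z2'_def a3_def
      by (simp add: rad \<sigma>_eq[OF rI] sin_k_eq[OF rI] power2_eq_square flip: v22_def)
    show ?thesis
      unfolding J_def Z1p Z2p lapV \<rho>_def using nz
      by (simp add: \<sigma>_eq[OF rI] G_def power2_eq_square field_simps flip: v_def)
  qed
  have int: "set_integrable lborel K Z1'" "set_integrable lborel K Z2'"
    unfolding set_integrable_def
    by (intro borel_integrable_compact K continuous_on_subset[OF contZ(2)] continuous_on_subset[OF contZ(4)])+
  have eq: "(\<lambda>p. indicator K p *\<^sub>R J p) = (\<lambda>p. indicator K p *\<^sub>R (Z1' p + Z2' p))"
    using J K(2) by (auto simp: fun_eq_iff indicator_def)
  show "set_integrable lborel K J"
    using set_integral_add(1)[OF int] unfolding set_integrable_def eq .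
  have "(LINT p:K|lborel. J p) = (LINT p:K|lborel. Z1' p + Z2' p)"
    unfolding set_lebesgue_integral_def eq ..
  then show "(LINT p:K|lborel. J p) = 0"
    using set_integral_add(2)[OF int] Z1_int Z2_int by simp
qed

end

section \<open>The first variation of the bienergy\<close>

lemma slice_has_derivative:
  assumes "smooth_on (T \<times> D) \<Psi>" "t \<in> T" "p \<in> D"
  shows "((\<lambda>q. \<Psi> (t, q)) has_derivative (\<lambda>v. dir_deriv (0, v) \<Psi> (t, p))) (at p)"
proof -
  have \<Psi>: "(\<Psi> has_derivative frechet_derivative \<Psi> (at (t, p))) (at (t, p))"
    using assms by (intro smooth_on_has_derivative[of "T \<times> D"]) auto
  have "((\<lambda>q. (t, q)) has_derivative (\<lambda>v. (0, v))) (at p)"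
    by (auto intro!: derivative_eq_intros)
  from has_derivative_compose[OF this \<Psi>] show ?thesis .
qed

lemma dir_deriv_slice:
  assumes "smooth_on (T \<times> D) \<Psi>" "t \<in> T" "p \<in> D"
  shows "dir_deriv v (\<lambda>q. \<Psi> (t, q)) p = dir_deriv (0, v) \<Psi> (t, p)"
  using frechet_derivative_at[OF slice_has_derivative[OF assms]] by metis

lemma smooth_on_slice:
  fixes \<Psi> :: "'a::real_normed_vector \<times> 'b::real_normed_vector \<Rightarrow> 'c::real_normed_vector"
  assumes D: "open D" and t: "t \<in> T" and \<Psi>: "smooth_on (T \<times> D) \<Psi>"
  shows "smooth_on D (\<lambda>q. \<Psi> (t, q))"
proof -
  have "higher_differentiable_on D n (\<lambda>q. \<Psi> (t, q))"
    if "smooth_on (T \<times> D) \<Psi>" for n and \<Psi> :: "'a \<times> 'b \<Rightarrow> 'c"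
    using that
  proof (induction n arbitrary: \<Psi>)
    case 0
    have "continuous_on D (\<lambda>q. \<Psi> (t, q))"
      by (rule continuous_on_compose2[OF smooth_on_continuous[OF 0]])
         (use t in \<open>auto intro: continuous_on_Pair continuous_on_const continuous_on_id\<close>)
    then show ?case by simp
  next
    case (Suc n)
    show ?case
      by (rule higher_differentiable_on_SucI[OF D slice_has_derivative[OF Suc.prems t]
          Suc.IH[OF smooth_on_dir_deriv[OF Suc.prems]]])
  qed
  then show ?thesis using \<Psi> by (simp add: smooth_on_def)
qed

lemma time_has_derivative:
  assumes "smooth_on (T \<times> D) \<Psi>" "t \<in> T" "p \<in> D"
  shows "((\<lambda>s. \<Psi> (s, p)) has_derivative (\<lambda>d. d *\<^sub>R dir_deriv (1, 0) \<Psi> (t, p))) (at t)"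
proof -
  have \<Psi>: "(\<Psi> has_derivative frechet_derivative \<Psi> (at (t, p))) (at (t, p))"
    using assms by (intro smooth_on_has_derivative[of "T \<times> D"]) auto
  have "((\<lambda>s. (s, p)) has_derivative (\<lambda>d. (d, 0))) (at t)"
    by (auto intro!: derivative_eq_intros)
  from has_derivative_compose[OF this \<Psi>]
  have chain: "((\<lambda>s. \<Psi> (s, p)) has_derivative (\<lambda>d. dir_deriv (d, 0) \<Psi> (t, p))) (at t)" .
  have "dir_deriv (d, 0) \<Psi> (t, p) = d *\<^sub>R dir_deriv (1, 0) \<Psi> (t, p)" for d
    using linear_cmul[OF has_derivative_linear[OF \<Psi>], of d "(1, 0)"] by simp
  then have "(\<lambda>d. dir_deriv (d, 0) \<Psi> (t, p)) = (\<lambda>d. d *\<^sub>R dir_deriv (1, 0) \<Psi> (t, p))"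
    by (rule ext)
  from chain[unfolded this] show ?thesis .
qed

lemma second_dir_deriv_commute:
  fixes f :: "'a::real_normed_vector \<Rightarrow> 'b::real_inner"
  assumes S: "open S" and x: "x \<in> S" and f: "smooth_on S f"
  shows "dir_deriv u (dir_deriv v (dir_deriv v f)) x = dir_deriv v (dir_deriv v (dir_deriv u f)) x"
proof -
  have "dir_deriv u (dir_deriv v (dir_deriv v f)) x = dir_deriv v (dir_deriv u (dir_deriv v f)) x"
    by (rule dir_deriv_commute[OF S x smooth_on_dir_deriv[OF f]])
  also have "frechet_derivative (dir_deriv u (dir_deriv v f)) (at x) =
      frechet_derivative (dir_deriv v (dir_deriv u f)) (at x)"
    by (rule frechet_derivative_transform_within_open[OF _ S x])
       (auto intro: smooth_on_differentiable smooth_on_dir_deriv f x dir_deriv_commute[OF S _ f])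
  finally show ?thesis .
qed

context harmonic_rotation_patch
begin

text \<open>\<open>lap\<close> and \<open>trace_hess\<close> in the space variables of a map of time and space, written with derivatives of the joint
  map so that time derivatives can be exchanged with them.\<close>

definition slice_lap :: "(real \<times> (real^2) \<Rightarrow> ambient) \<Rightarrow> real \<times> (real^2) \<Rightarrow> ambient" where
  "slice_lap \<Psi> x = (1 / E (snd x $ 1)) *\<^sub>R dir_deriv (0, axis 1 1) (dir_deriv (0, axis 1 1) \<Psi>) x
    + (1 / G (snd x $ 1)) *\<^sub>R dir_deriv (0, axis 2 1) (dir_deriv (0, axis 2 1) \<Psi>) x
    + drift (snd x $ 1) *\<^sub>R dir_deriv (0, axis 1 1) \<Psi> x"

definition slice_trace_hess :: "(real \<times> (real^2) \<Rightarrow> ambient) \<Rightarrow> real \<times> (real^2) \<Rightarrow> real^3" where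
  "slice_trace_hess \<Psi> x = (1 / E (snd x $ 1)) *\<^sub>R fst (dir_deriv (0, axis 1 1) (dir_deriv (0, axis 1 1) \<Psi>) x)
    + (1 / G (snd x $ 1)) *\<^sub>R fst (dir_deriv (0, axis 2 1) (dir_deriv (0, axis 2 1) \<Psi>) x)"

lemma partial_deriv_slice:
  fixes T :: "real set" and \<Psi> :: "real \<times> (real^2) \<Rightarrow> 'c::real_normed_vector"
  assumes "smooth_on (T \<times> D) \<Psi>" "t \<in> T" "p \<in> D"
  shows "partial_deriv i (\<lambda>q. \<Psi> (t, q)) p = dir_deriv (0, axis i 1) \<Psi> (t, p)"
    and "partial_deriv j (partial_deriv i (\<lambda>q. \<Psi> (t, q))) p =
      dir_deriv (0, axis j 1) (dir_deriv (0, axis i 1) \<Psi>) (t, p)"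
proof -
  have first: "partial_deriv i (\<lambda>q. \<Psi> (t, q)) p = dir_deriv (0, axis i 1) \<Psi> (t, p)"
    if "smooth_on (T \<times> D) \<Psi>" "p \<in> D" for \<Psi> :: "real \<times> (real^2) \<Rightarrow> 'c" and p i
    unfolding partial_deriv_def by (rule dir_deriv_slice[OF that(1) assms(2) that(2)])
  show "partial_deriv i (\<lambda>q. \<Psi> (t, q)) p = dir_deriv (0, axis i 1) \<Psi> (t, p)"
    by (rule first[OF assms(1,3)])
  have "partial_deriv j (partial_deriv i (\<lambda>q. \<Psi> (t, q))) p =
      partial_deriv j (\<lambda>q. dir_deriv (0, axis i 1) \<Psi> (t, q)) p"
    by (rule partial_deriv_cong[OF open_D assms(3) first[OF assms(1)]])
  also have "\<dots> = dir_deriv (0, axis j 1) (dir_deriv (0, axis i 1) \<Psi>) (t, p)"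
    by (rule first[OF smooth_on_dir_deriv[OF assms(1)] assms(3)])
  finally show "partial_deriv j (partial_deriv i (\<lambda>q. \<Psi> (t, q))) p = \<dots>" .
qed

lemma lap_slice:
  assumes "smooth_on (T \<times> D) \<Psi>" "t \<in> T" "p \<in> D"
  shows "lap (\<lambda>q. \<Psi> (t, q)) p = slice_lap \<Psi> (t, p)"
    and "trace_hess (\<lambda>q. \<Psi> (t, q)) p = slice_trace_hess \<Psi> (t, p)"
  by (simp_all add: lap_def slice_lap_def trace_hess_def slice_trace_hess_def partial_deriv_slice[OF assms])

lemma time_derivative_slice_lap:
  assumes T: "open T" and \<Psi>: "smooth_on (T \<times> D) \<Psi>" and t: "t \<in> T" and p: "p \<in> D"
  shows "((\<lambda>s. slice_lap \<Psi> (s, p)) has_derivative (\<lambda>d. d *\<^sub>R slice_lap (dir_deriv (1, 0) \<Psi>) (t, p))) (at t)"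
    and "((\<lambda>s. slice_trace_hess \<Psi> (s, p)) has_derivative
      (\<lambda>d. d *\<^sub>R slice_trace_hess (dir_deriv (1, 0) \<Psi>) (t, p))) (at t)"
proof -
  have S: "open (T \<times> D)" "(t, p) \<in> T \<times> D" using T open_D t p by (auto intro: open_Times)
  have first: "((\<lambda>s. dir_deriv u \<Psi> (s, p)) has_derivative
      (\<lambda>d. d *\<^sub>R dir_deriv u (dir_deriv (1, 0) \<Psi>) (t, p))) (at t)" for u
    using time_has_derivative[OF smooth_on_dir_deriv[OF \<Psi>] t p, of u]
    unfolding dir_deriv_commute[OF S \<Psi>, of "(1, 0)"] .
  have second: "((\<lambda>s. dir_deriv u (dir_deriv u \<Psi>) (s, p)) has_derivative
      (\<lambda>d. d *\<^sub>R dir_deriv u (dir_deriv u (dir_deriv (1, 0) \<Psi>)) (t, p))) (at t)" for u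
    using time_has_derivative[OF smooth_on_dir_deriv[OF smooth_on_dir_deriv[OF \<Psi>]] t p, of u u]
    unfolding second_dir_deriv_commute[OF S \<Psi>, where u = "(1, 0)"] .
  show "((\<lambda>s. slice_lap \<Psi> (s, p)) has_derivative (\<lambda>d. d *\<^sub>R slice_lap (dir_deriv (1, 0) \<Psi>) (t, p))) (at t)"
    unfolding slice_lap_def snd_conv
    by (rule has_derivative_eq_rhs[OF has_derivative_add[OF has_derivative_add[OF
          has_derivative_scaleR_right[OF second] has_derivative_scaleR_right[OF second]]
          has_derivative_scaleR_right[OF first]]])
       (simp add: scaleR_add_right mult.commute)
  show "((\<lambda>s. slice_trace_hess \<Psi> (s, p)) has_derivative
      (\<lambda>d. d *\<^sub>R slice_trace_hess (dir_deriv (1, 0) \<Psi>) (t, p))) (at t)"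
    unfolding slice_trace_hess_def snd_conv
    by (rule has_derivative_eq_rhs[OF has_derivative_add[OF
          has_derivative_scaleR_right[OF has_derivative_fst[OF second]]
          has_derivative_scaleR_right[OF has_derivative_fst[OF second]]]])
       (simp add: scaleR_add_right mult.commute)
qed

lemma continuous_slice_lap:
  assumes \<Psi>: "smooth_on (T \<times> D) \<Psi>"
  shows "continuous_on (T \<times> D) (slice_lap \<Psi>)" "continuous_on (T \<times> D) (slice_trace_hess \<Psi>)"
proof -
  have r: "continuous_on (T \<times> D) (\<lambda>x. a (snd x $ 1))" if "continuous_on I a" for a :: "real \<Rightarrow> real"
    by (rule continuous_on_compose2[OF that]) (auto intro!: continuous_intros)
  have nz: "E r \<noteq> 0" "G r \<noteq> 0" if "r \<in> I" for r using E_pos[OF that] G_pos[OF that] by auto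
  have inv: "continuous_on I (\<lambda>r. 1 / E r)" "continuous_on I (\<lambda>r. 1 / G r)"
    by (intro continuous_on_divide continuous_on_const continuous_coefficients ballI nz; assumption)+
  show "continuous_on (T \<times> D) (slice_lap \<Psi>)" "continuous_on (T \<times> D) (slice_trace_hess \<Psi>)"
    unfolding slice_lap_def[abs_def] slice_trace_hess_def[abs_def]
    by (intro continuous_on_add continuous_on_scaleR continuous_on_fst smooth_on_continuous
        smooth_on_dir_deriv \<Psi> r[OF inv(1)] r[OF inv(2)] r[OF continuous_coefficients(4)])+
qed

lemma variation_field:
  assumes K: "compact K" "K \<subseteq> D" and e: "0 < e" and var: "variation_of D K \<phi> e F"
  defines "V \<equiv> \<lambda>p. dir_deriv (1, 0) (\<lambda>(t, p). F t p) (0, p)"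
  shows "smooth_on D V" and "\<And>p. p \<in> D - K \<Longrightarrow> V p = 0"
    and "\<And>p. p \<in> D \<Longrightarrow> fst (V p) \<bullet> sphere_part p = 0"
proof -
  let ?T = "{-e<..<e}" and ?\<Phi> = "\<lambda>(t, p). F t p"
  have \<Phi>: "smooth_on (?T \<times> D) ?\<Phi>" using var by (simp add: variation_of_def)
  have t0: "0 \<in> ?T" and oT: "open ?T" using e by auto
  show "smooth_on D V"
    unfolding V_def by (rule smooth_on_slice[OF open_D t0 smooth_on_dir_deriv[OF \<Phi>]])
  have time: "((\<lambda>s. F s p) has_derivative (\<lambda>d. d *\<^sub>R V p)) (at 0)" if "p \<in> D" for p
    using time_has_derivative[OF \<Phi> t0 that] by (simp add: V_def)
  show "V p = 0" if p: "p \<in> D - K" for p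
  proof -
    have "((\<lambda>s. F s p) has_derivative (\<lambda>d. 0)) (at 0)"
      by (rule has_derivative_transform_within_open[OF has_derivative_const[of "\<phi> p"] oT t0])
         (use var p in \<open>auto simp: variation_of_def\<close>)
    with time[of p] p have "(\<lambda>d. d *\<^sub>R V p) = (\<lambda>d. 0)" using has_derivative_unique by blast
    then show ?thesis by (metis scaleR_one)
  qed
  show "fst (V p) \<bullet> sphere_part p = 0" if p: "p \<in> D" for p
  proof -
    have F0: "fst (F 0 p) = sphere_part p"
      using var p by (simp add: variation_of_def rotation_surface_eq)
    have "((\<lambda>s. fst (F s p) \<bullet> fst (F s p)) has_derivative
        (\<lambda>d. fst (F 0 p) \<bullet> fst (d *\<^sub>R V p) + fst (d *\<^sub>R V p) \<bullet> fst (F 0 p))) (at 0)"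
      by (intro has_derivative_inner has_derivative_fst time p)
    moreover have "((\<lambda>s. fst (F s p) \<bullet> fst (F s p)) has_derivative (\<lambda>d. 0)) (at 0)"
    proof (rule has_derivative_transform_within_open[OF has_derivative_const[of 1] oT t0])
      fix s assume "s \<in> ?T"
      then have "F s p \<in> S2xR" using var p by (auto simp: variation_of_def)
      then show "1 = fst (F s p) \<bullet> fst (F s p)"
        by (auto simp: S2xR_def norm_eq_1 mem_Times_iff)
    qed
    ultimately have "(\<lambda>d. fst (F 0 p) \<bullet> fst (d *\<^sub>R V p) + fst (d *\<^sub>R V p) \<bullet> fst (F 0 p)) = (\<lambda>d. 0)"
      by (rule has_derivative_unique)
    from fun_cong[OF this, of 1] show ?thesis by (simp add: F0 inner_commute)
  qed
qed

text \<open>The tension field \<open>\<tau>\<close> of \<open>F t\<close> is a polynomial in the joint map and its space derivatives. At time zero the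
  sphere component of \<open>\<tau>\<close> is orthogonal to the position vector, so \<open>\<langle>\<tau>, \<partial>\<^sub>t \<tau>\<rangle>\<close> reduces to
  \<open>\<langle>\<tau>, \<Delta>V\<rangle>\<close> plus \<open>k'\<^sup>2/E + 1\<close> times \<open>\<langle>\<tau>, V\<rangle>\<close> on the sphere factor, where \<open>k'\<^sup>2/E + 1\<close> is the squared length of
  the differential of \<open>X\<close>. Green's formula then removes the derivatives from the sphere component of \<open>V\<close>.\<close>

lemma first_variation:
  assumes K: "compact K" "K \<subseteq> D" and e: "0 < e" and var: "variation_of D K \<phi> e F"
  defines "V \<equiv> \<lambda>p. dir_deriv (1, 0) (\<lambda>(t, p). F t p) (0, p)"
  shows "((\<lambda>t. bienergy g K (F t)) has_real_derivative
    (LINT p:K|lborel. \<sigma> (p $ 1) *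
      (\<rho> (p $ 1) * (fst (V p) \<bullet> meridian p) + height_tension (p $ 1) * snd (lap V p)))) (at 0)"
proof -
  let ?T = "{-e<..<e}"
  define \<Phi> where "\<Phi> = (\<lambda>(t, p). F t p)"
  define \<Phi>' where "\<Phi>' = dir_deriv (1, 0) \<Phi>"
  have \<Phi>: "smooth_on (?T \<times> D) \<Phi>" using var by (simp add: variation_of_def \<Phi>_def)
  have \<Phi>': "smooth_on (?T \<times> D) \<Phi>'" unfolding \<Phi>'_def by (rule smooth_on_dir_deriv[OF \<Phi>])
  have t0: "0 \<in> ?T" and oT: "open ?T" using e by auto
  have V: "V = (\<lambda>p. \<Phi>' (0, p))" by (simp add: V_def \<Phi>'_def \<Phi>_def)
  have V_smooth: "smooth_on D V" unfolding V_def by (rule variation_field(1)[OF K e var])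
  have V_supp: "V p = 0" if "p \<in> D - K" for p
    unfolding V_def by (rule variation_field(2)[OF K e var that])
  have V_tang: "fst (V p) \<bullet> sphere_part p = 0" if "p \<in> D" for p
    unfolding V_def by (rule variation_field(3)[OF K e var that])
  define \<tau> where "\<tau> x = slice_lap \<Phi> x - ((slice_trace_hess \<Phi> x \<bullet> fst (\<Phi> x)) *\<^sub>R fst (\<Phi> x), 0)" for x
  define \<tau>' where "\<tau>' x = slice_lap \<Phi>' x - ((slice_trace_hess \<Phi> x \<bullet> fst (\<Phi> x)) *\<^sub>R fst (\<Phi>' x)
    + (slice_trace_hess \<Phi> x \<bullet> fst (\<Phi>' x) + slice_trace_hess \<Phi>' x \<bullet> fst (\<Phi> x)) *\<^sub>R fst (\<Phi> x), 0)" for x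
  define m where "m t p = \<sigma> (p $ 1) / 2 * (\<tau> (t, p) \<bullet> \<tau> (t, p))" for t p
  define m' where "m' t p = \<sigma> (p $ 1) * (\<tau> (t, p) \<bullet> \<tau>' (t, p))" for t p
  have tension: "tension_field g (F t) p = \<tau> (t, p)" if "t \<in> ?T" "p \<in> D" for t p
  proof -
    have "F t = (\<lambda>q. \<Phi> (t, q))" by (simp add: \<Phi>_def)
    then show ?thesis
      using tension_field_eq[OF that(2), of "F t"] lap_slice[OF \<Phi> that] by (simp add: \<tau>_def)
  qed
  have bienergy: "bienergy g K (F t) = (LINT p:K|lborel. m t p)" if t: "t \<in> ?T" for t
  proof -
    have "1/2 * ((norm (tension_field g (F t) p))\<^sup>2 * sqrt (det (g p))) = m t p" if "p \<in> K" for p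
    proof -
      have p: "p \<in> D" using that K by auto
      have "det (g p) = E (p $ 1) * G (p $ 1)" by (simp add: det_2 metric_eq[OF p])
      then show ?thesis
        by (simp add: m_def tension[OF t p] \<sigma>_def power2_norm_eq_inner)
    qed
    then have "(\<lambda>p. indicator K p *\<^sub>R (1/2 * ((norm (tension_field g (F t) p))\<^sup>2 * sqrt (det (g p))))) =
        (\<lambda>p. indicator K p *\<^sub>R m t p)"
      by (auto simp: fun_eq_iff indicator_def)
    then show ?thesis
      unfolding bienergy_def
      by (subst set_integral_mult_right[symmetric]) (simp only: set_lebesgue_integral_def)
  qed
  have time: "((\<lambda>s. \<tau> (s, p)) has_derivative (\<lambda>d. d *\<^sub>R \<tau>' (t, p))) (at t)" if "t \<in> ?T" "p \<in> D" for t p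
  proof -
    note l = time_derivative_slice_lap(1)[OF oT \<Phi> that] and th = time_derivative_slice_lap(2)[OF oT \<Phi> that]
      and ph = has_derivative_fst[OF time_has_derivative[OF \<Phi> that]]
    show ?thesis
      unfolding \<tau>_def
      by (rule has_derivative_eq_rhs[OF has_derivative_diff[OF l has_derivative_Pair[OF
            has_derivative_scaleR[OF has_derivative_inner[OF th ph] ph] has_derivative_const]]])
         (simp add: \<tau>'_def \<Phi>'_def fun_eq_iff prod_eq_iff scaleR_diff_right algebra_simps)
  qed
  have m: "((\<lambda>s. m s p) has_real_derivative m' t p) (at t)" if "t \<in> ?T" "p \<in> D" for t p
    unfolding m_def
    by (rule has_derivative_imp_has_field_derivative[OF
          has_derivative_mult_right[OF has_derivative_inner[OF time[OF that] time[OF that]]]])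
       (simp add: m'_def inner_commute)
  have cont\<tau>: "continuous_on (?T \<times> D) \<tau>" "continuous_on (?T \<times> D) \<tau>'"
    unfolding \<tau>_def[abs_def] \<tau>'_def[abs_def]
    by (intro continuous_on_diff continuous_on_add continuous_on_Pair continuous_on_scaleR continuous_on_inner continuous_on_fst
        continuous_slice_lap[OF \<Phi>] continuous_slice_lap[OF \<Phi>'] smooth_on_continuous[OF \<Phi>] smooth_on_continuous[OF \<Phi>'] continuous_on_const)+
  have cont_m': "continuous_on (?T \<times> D) (\<lambda>(t, p). m' t p)"
  proof -
    have "continuous_on (?T \<times> D) (\<lambda>x. \<sigma> (snd x $ 1))"
      by (rule continuous_on_compose2[OF continuous_coefficients(5)])
         (auto intro!: continuous_intros)
    then have "continuous_on (?T \<times> D) (\<lambda>x. \<sigma> (snd x $ 1) * (\<tau> x \<bullet> \<tau>' x))"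
      by (intro continuous_on_mult continuous_on_inner cont\<tau>)
    then show ?thesis by (simp add: m'_def case_prod_beta)
  qed
  have cont_slice: "continuous_on K (\<lambda>p. f (t, p))" if "continuous_on (?T \<times> D) f" "t \<in> ?T"
    for t and f :: "real \<times> (real^2) \<Rightarrow> 'z::real_normed_vector"
    by (rule continuous_on_compose2[OF that(1)])
       (use K that in \<open>auto intro: continuous_on_Pair continuous_on_const continuous_on_id\<close>)
  have cont_\<sigma>: "continuous_on K (\<lambda>p. \<sigma> (p $ 1))"
    by (rule continuous_on_subset[OF continuous_on_of_r[OF continuous_coefficients(5)] K(2)])
  have "((\<lambda>t. LINT p:K|lborel. m t p) has_real_derivative (LINT p:K|lborel. m' 0 p)) (at 0)"
  proof (rule has_real_derivative_set_integral_compact[OF K(1) e])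
    show "((\<lambda>s. m s p) has_real_derivative m' t p) (at t)" if "t \<in> ?T" "p \<in> K" for t p
      using m that K by blast
    show "continuous_on K (m t)" if "t \<in> ?T" for t
      unfolding m_def[abs_def]
      by (intro continuous_on_mult continuous_on_divide continuous_on_const continuous_on_inner
          cont_\<sigma> cont_slice[OF cont\<tau>(1) that]) simp
    show "continuous_on (?T \<times> K) (\<lambda>(t, p). m' t p)"
      by (rule continuous_on_subset[OF cont_m']) (use K in auto)
  qed
  then have main: "((\<lambda>t. bienergy g K (F t)) has_real_derivative (LINT p:K|lborel. m' 0 p)) (at 0)"
    by (rule has_field_derivative_transform_within_open[OF _ oT t0]) (simp add: bienergy)
  define J where "J p = \<sigma> (p $ 1) * (tan_k (p $ 1) * (fst (lap V p) \<bullet> meridian p)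
    + (((k1 (p $ 1))\<^sup>2 / E (p $ 1) + 1) * tan_k (p $ 1) - \<rho> (p $ 1)) * (fst (V p) \<bullet> meridian p))" for p
  note J = integral_by_parts[OF K V_smooth V_supp V_tang, folded J_def]
  have int_m': "set_integrable lborel K (m' 0)"
    unfolding set_integrable_def
    by (rule borel_integrable_compact[OF K(1)]) (use cont_slice[OF cont_m' t0] in simp)
  have target: "\<sigma> (p $ 1) * (\<rho> (p $ 1) * (fst (V p) \<bullet> meridian p) + height_tension (p $ 1) * snd (lap V p)) = m' 0 p - J p"
    if "p \<in> K" for p
  proof -
    have p: "p \<in> D" using that K by auto
    have \<phi>: "F 0 p = \<phi> p" if "p \<in> D" for p using var that by (simp add: variation_of_def)
    have F0_first: "partial_deriv i (F 0) p = partial_deriv i \<phi> p" if "p \<in> D" for i p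
      by (rule partial_deriv_cong[OF open_D that \<phi>])
    have F0_second: "partial_deriv j (partial_deriv i (F 0)) p = partial_deriv j (partial_deriv i \<phi>) p" for i j
      by (rule partial_deriv_cong[OF open_D p F0_first])
    have F0: "fst (\<Phi> (0, p)) = sphere_part p" by (simp add: \<Phi>_def \<phi>[OF p] rotation_surface_eq)
    have "F 0 = (\<lambda>q. \<Phi> (0, q))" by (simp add: \<Phi>_def)
    then have "slice_trace_hess \<Phi> (0, p) = trace_hess (F 0) p" using lap_slice(2)[OF \<Phi> t0 p] by simp
    also have "\<dots> = trace_hess \<phi> p" by (simp add: trace_hess_def F0_second)
    finally have th: "slice_trace_hess \<Phi> (0, p) \<bullet> sphere_part p = - ((k1 (p $ 1))\<^sup>2 / E (p $ 1)) - 1"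
      by (simp add: trace_hess_rotation_surface[OF p])
    have \<tau>0: "\<tau> (0, p) = (tan_k (p $ 1) *\<^sub>R meridian p, height_tension (p $ 1))"
    proof -
      have "tension_field g (F 0) p = tension_field g \<phi> p"
        by (simp add: tension_field_eq[OF p] lap_def trace_hess_def F0_first[OF p] F0_second \<phi>[OF p])
      then show ?thesis using tension[OF t0 p] tension_rotation_surface[OF p] by simp
    qed
    have lapV: "slice_lap \<Phi>' (0, p) = lap V p" using lap_slice(1)[OF \<Phi>' t0 p] V by simp
    have Vp: "\<Phi>' (0, p) = V p" by (simp add: V)
    define a where "a = slice_trace_hess \<Phi> (0, p) \<bullet> fst (V p) + slice_trace_hess \<Phi>' (0, p) \<bullet> sphere_part p"
    have \<tau>'0: "\<tau>' (0, p) = lap V p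
        - ((- ((k1 (p $ 1))\<^sup>2 / E (p $ 1)) - 1) *\<^sub>R fst (V p) + a *\<^sub>R sphere_part p, 0)"
      unfolding \<tau>'_def lapV Vp F0 th a_def ..
    have "m' 0 p = \<sigma> (p $ 1) * (tan_k (p $ 1) * (meridian p \<bullet> fst (lap V p)
        - (- ((k1 (p $ 1))\<^sup>2 / E (p $ 1)) - 1) * (meridian p \<bullet> fst (V p))) + height_tension (p $ 1) * snd (lap V p))"
      unfolding m'_def \<tau>0 \<tau>'0
      by (simp add: inner_prod_def inner_diff_right inner_add_right right_diff_distrib mult.left_commute)
    then have "m' 0 p = \<sigma> (p $ 1) * (tan_k (p $ 1) * (fst (lap V p) \<bullet> meridian p)
        + ((k1 (p $ 1))\<^sup>2 / E (p $ 1) + 1) * tan_k (p $ 1) * (fst (V p) \<bullet> meridian p) + height_tension (p $ 1) * snd (lap V p))"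
      by (simp add: inner_commute algebra_simps)
    then show ?thesis by (simp add: J_def algebra_simps)
  qed
  have "(LINT p:K|lborel. \<sigma> (p $ 1) * (\<rho> (p $ 1) * (fst (V p) \<bullet> meridian p) + height_tension (p $ 1) * snd (lap V p)))
      = (LINT p:K|lborel. m' 0 p - J p)"
    by (rule set_lebesgue_integral_cong) (use K in \<open>auto simp: target intro: borel_compact\<close>)
  also have "\<dots> = (LINT p:K|lborel. m' 0 p)"
    using set_integral_diff(2)[OF int_m' J(2)] J(1) by simp
  finally show ?thesis using main by simp
qed

end

section \<open>Biharmonic and minimal surfaces\<close>

text \<open>A function with zero integral would vanish almost everywhere on \<open>U\<close>, but a nonempty open set is not null.\<close>

lemma set_integral_pos_of_continuous:
  fixes f :: "'a::euclidean_space \<Rightarrow> real"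
  assumes K: "compact K" and f: "continuous_on K f" and nonneg: "\<And>p. p \<in> K \<Longrightarrow> 0 \<le> f p"
    and U: "open U" "U \<noteq> {}" "U \<subseteq> K" and pos: "\<And>p. p \<in> U \<Longrightarrow> 0 < f p"
  shows "(LINT p:K|lborel. f p) \<noteq> 0"
proof
  assume 0: "(LINT p:K|lborel. f p) = 0"
  have "AE p in lborel. indicator K p *\<^sub>R f p = 0"
  proof (rule integral_nonneg_eq_0_iff_AE[THEN iffD1])
    show "integrable lborel (\<lambda>p. indicator K p *\<^sub>R f p)" by (rule borel_integrable_compact[OF K f])
    show "AE p in lborel. 0 \<le> indicator K p *\<^sub>R f p"
      using nonneg by (auto simp: indicator_def)
    show "(LINT p|lborel. indicator K p *\<^sub>R f p) = 0"
      using 0 by (simp add: set_lebesgue_integral_def)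
  qed
  then have "AE p in lborel. p \<notin> U"
    by (rule AE_mp) (use pos U(3) in \<open>force simp: indicator_def intro!: AE_I2\<close>)
  then have "U \<in> null_sets lborel"
    using U(1) by (simp add: AE_iff_null_sets)
  then have "negligible U"
    using null_sets_completionI[of U lborel] by (simp add: negligible_iff_null_sets)
  then show False using open_not_negligible U by blast
qed

lemma inj_on_of_nonzero_derivative:
  fixes f :: "real \<Rightarrow> real"
  assumes S: "connected S" and f: "\<And>x. x \<in> S \<Longrightarrow> (f has_real_derivative f' x) (at x)"
    and nz: "\<And>x. x \<in> S \<Longrightarrow> f' x \<noteq> 0"
  shows "inj_on f S"
proof -
  have neq: "f a \<noteq> f b" if ab: "a \<in> S" "b \<in> S" "a < b" for a b
  proof
    assume eq: "f a = f b"
    have sub: "x \<in> S" if "a \<le> x" "x \<le> b" for x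
      using connectedD_interval[OF S ab(1,2) that] .
    obtain z where z: "a < z" "z < b" "f b - f a = (b - a) * f' z"
      using MVT2[OF ab(3), of f f'] f sub by blast
    with eq ab(3) nz[OF sub[of z]] show False by simp
  qed
  show ?thesis
    by (rule inj_onI) (metis neq linorder_neqE_linordered_idom)
qed

context harmonic_rotation_patch
begin

text \<open>Since \<open>A\<^sup>2 = G/E\<close> and \<open>1/G = 1 + tan\<^sup>2 k\<close>, constant flux turns \<open>k'\<^sup>2/E\<close> into \<open>c\<^sup>2 (1 + tan\<^sup>2 k)\<close>.\<close>

lemma \<rho>_eq:
  assumes r: "r \<in> I" and c: "A r * k1 r = c"
  shows "\<rho> r = tan_k r * (2 * c\<^sup>2 * (1 + (tan_k r)\<^sup>2)\<^sup>2 + 1 - (tan_k r)\<^sup>2)"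
proof -
  have pos: "E r \<noteq> 0" "G r \<noteq> 0" "cos (k r) \<noteq> 0"
    using E_pos[OF r] G_pos[OF r] cos_k_nonzero[OF r] by auto
  have "(A r)\<^sup>2 = G r / E r" using E_pos[OF r] G_pos[OF r] by (simp add: A_def)
  then have "c\<^sup>2 = G r / E r * (k1 r)\<^sup>2" unfolding c[symmetric] by (simp add: power_mult_distrib)
  then have "(k1 r)\<^sup>2 / E r = c\<^sup>2 * (1 / G r)" using pos by (simp add: field_simps)
  also have "1 / G r = 1 + (tan_k r)\<^sup>2"
    using pos sin_cos_squared_add[of "k r"]
    by (simp add: G_def tan_k_def tan_def field_simps)
  finally show ?thesis by (simp add: \<rho>_def power2_eq_square algebra_simps)
qed

text \<open>For \<open>c \<noteq> 0\<close> the derivative of \<open>tan k\<close> has no zero, so \<open>tan k\<close> would map the interval injectively into the finite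
  root set of a nonzero polynomial.\<close>

lemma \<rho>_zero_imp_constant:
  assumes \<rho>: "\<And>r. r \<in> I \<Longrightarrow> \<rho> r = 0" and r: "r \<in> I"
  shows "k1 r = 0" and "tan_k r = 0 \<or> (tan_k r)\<^sup>2 = 1"
proof -
  obtain c where c: "\<And>r. r \<in> I \<Longrightarrow> A r * k1 r = c" using flux_constant by blast
  have "c = 0"
  proof (rule ccontr)
    assume "c \<noteq> 0"
    then have k1: "k1 s \<noteq> 0" if "s \<in> I" for s using c[OF that] by auto
    have "1 + (tan_k s)\<^sup>2 \<noteq> 0" for s by (smt (verit) zero_le_power2)
    then have "inj_on tan_k I"
      using k1 by (intro inj_on_of_nonzero_derivative[OF connected_I tan_k_deriv]) auto
    moreover have "infinite I"
      using open_I r finite_imp_not_open by blast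
    ultimately have "infinite (tan_k ` I)" using finite_imageD by blast
    (* the coefficients of w (2 c^2 (1 + w^2)^2 + 1 - w^2) *)
    moreover define P where "P = [:0, 2 * c\<^sup>2 + 1, 0, 4 * c\<^sup>2 - 1, 0, 2 * c\<^sup>2:]"
    have "poly P (tan_k s) = \<rho> s" if "s \<in> I" for s
      unfolding \<rho>_eq[OF that c[OF that]] P_def by (simp add: power2_eq_square algebra_simps)
    then have "tan_k ` I \<subseteq> {x. poly P x = 0}" using \<rho> by auto
    moreover have "P \<noteq> 0" using \<open>c \<noteq> 0\<close> by (simp add: P_def)
    ultimately show False using poly_roots_finite finite_subset by blast
  qed
  then show "k1 r = 0" using c[OF r] A_pos[OF r] by auto
  have "tan_k r * (1 - (tan_k r)\<^sup>2) = 0"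
    using \<rho>_eq[OF r c[OF r]] \<rho>[OF r] \<open>c = 0\<close> by simp
  then show "tan_k r = 0 \<or> (tan_k r)\<^sup>2 = 1" by auto
qed

lemma constant_imp_height_tension_zero:
  assumes r: "r \<in> I" and k1: "k1 r = 0" shows "height_tension r = 0"
proof -
  have "h1 r \<noteq> 0" using E_pos[OF r] k1 by (auto simp: E_def)
  then show ?thesis using tension_normal[OF r] k1 by simp
qed

lemma constant_imp_biharmonic:
  assumes k1: "\<And>r. r \<in> I \<Longrightarrow> k1 r = 0" and w: "\<And>r. r \<in> I \<Longrightarrow> tan_k r = 0 \<or> (tan_k r)\<^sup>2 = 1"
  shows "biharmonic_surface D \<phi>"
  unfolding biharmonic_surface_def biharmonic_map_def
proof (intro allI impI, elim conjE)
  fix K e F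
  assume K: "compact K" "K \<subseteq> D" and e: "0 < e" and var: "variation_of D K \<phi> e F"
  let ?V = "\<lambda>p. dir_deriv (1, 0) (\<lambda>(t, p). F t p) (0, p)"
  have 0: "\<rho> r = 0" "height_tension r = 0" if "r \<in> I" for r
    using w[OF that] by (auto simp: \<rho>_def k1[OF that] constant_imp_height_tension_zero[OF that])
  have integrand: "indicator K p *\<^sub>R (\<sigma> (p $ 1) *
      (\<rho> (p $ 1) * (fst (?V p) \<bullet> meridian p) + height_tension (p $ 1) * snd (lap ?V p))) = 0" for p
    using 0[of "p $ 1"] K(2) by (cases "p \<in> K") auto
  have "(LINT p:K|lborel. \<sigma> (p $ 1) *
      (\<rho> (p $ 1) * (fst (?V p) \<bullet> meridian p) + height_tension (p $ 1) * snd (lap ?V p))) = 0"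
    unfolding set_lebesgue_integral_def integrand by simp
  with first_variation[OF K e var] show "((\<lambda>t. bienergy g K (F t)) has_real_derivative 0) (at 0)"
    by metis
qed

lemma snd_partial_deriv_zero:
  fixes u :: "real^2 \<Rightarrow> ambient"
  assumes u: "smooth_on D u" and 0: "\<And>p. p \<in> D \<Longrightarrow> snd (u p) = 0" and p: "p \<in> D"
  shows "snd (partial_deriv i u p) = 0"
proof -
  have "partial_deriv i (\<lambda>q. snd (u q)) p = partial_deriv i (\<lambda>_. 0) p"
    by (rule partial_deriv_cong[OF open_D p 0])
  then show ?thesis
    using partial_derivI[OF has_derivative_snd[OF smooth_on_has_derivative[OF u p]], of i]
    by (simp add: partial_deriv_const) (simp add: partial_deriv_def)
qed

text \<open>The squared distance is a polynomial in the coordinates, so smoothness follows from the product rule.\<close>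

definition bump :: "real^2 \<Rightarrow> real \<Rightarrow> real^2 \<Rightarrow> real" where
  "bump a \<delta> p = flat_exp 1 (\<delta> * \<delta> - ((p $ 1 - a $ 1) * (p $ 1 - a $ 1) + (p $ 2 - a $ 2) * (p $ 2 - a $ 2)))"

lemma dist_squared_2: "(dist p a)\<^sup>2 = (p $ 1 - a $ 1) * (p $ 1 - a $ 1) + (p $ 2 - a $ 2) * (p $ 2 - (a::real^2) $ 2)"
  by (simp add: dist_norm power2_norm_eq_inner inner_vec_def sum_2)

lemma bump_pos: "p \<in> ball a \<delta> \<Longrightarrow> 0 < bump a \<delta> p"
  and bump_zero: "p \<notin> ball a \<delta> \<Longrightarrow> 0 < \<delta> \<Longrightarrow> bump a \<delta> p = 0"
proof -
  have bump: "bump a \<delta> p = flat_exp 1 (\<delta>\<^sup>2 - (dist p a)\<^sup>2)"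
    unfolding dist_squared_2 by (simp add: bump_def power2_eq_square)
  show "0 < bump a \<delta> p" if "p \<in> ball a \<delta>"
  proof -
    have "(dist p a)\<^sup>2 < \<delta>\<^sup>2" using that by (intro power_strict_mono) (auto simp: dist_commute)
    then show ?thesis by (simp add: bump flat_exp_def)
  qed
  show "bump a \<delta> p = 0" if "p \<notin> ball a \<delta>" "0 < \<delta>"
  proof -
    have "\<delta>\<^sup>2 \<le> (dist p a)\<^sup>2" using that by (intro power_mono) (auto simp: dist_commute)
    then show ?thesis by (simp add: bump flat_exp_def)
  qed
qed

text \<open>Moves each point along its meridian by the angle \<open>t\<close> times a bump function, so that the variation field is
  the bump function times \<open>N\<close>.\<close>

definition bump_variation :: "real^2 \<Rightarrow> real \<Rightarrow> real \<Rightarrow> real^2 \<Rightarrow> ambient" where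
  "bump_variation a \<delta> t p =
    (sin (k (p $ 1) + t * bump a \<delta> p) *\<^sub>R pole + cos (k (p $ 1) + t * bump a \<delta> p) *\<^sub>R radial (p $ 2), h (p $ 1))"

lemma smooth_bump_variation:
  "smooth_on ({-1<..<1} \<times> D) (\<lambda>(t, p). bump_variation a \<delta> t p)"
proof -
  let ?S = "{-1<..<1::real} \<times> D"
  have S: "open ?S" using open_D by (intro open_Times) auto
  have bl: "bounded_linear (\<lambda>x::real \<times> (real^2). snd x $ i)" for i
    by (rule bounded_linear_compose[OF bounded_linear_vec_nth bounded_linear_snd])
  have c: "smooth_on ?S (\<lambda>x. snd x $ i)" for i by (rule smooth_on_bounded_linear[OF bl])
  have t: "smooth_on ?S fst" by (rule smooth_on_bounded_linear[OF bounded_linear_fst])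
  have k: "smooth_on ?S (\<lambda>x. k (snd x $ 1))" and h: "smooth_on ?S (\<lambda>x. h (snd x $ 1))"
    by (rule smooth_on_compose_real[OF S c smooth_k] smooth_on_compose_real[OF S c smooth_h]; force)+
  have b: "smooth_on ?S (\<lambda>x. bump a \<delta> (snd x))"
    unfolding bump_def
    by (rule smooth_on_compose_real[OF S _ smooth_on_flat_exp[of 1]])
       (intro smooth_on_diff smooth_on_add smooth_on_mult smooth_on_const c S, simp)
  define \<kappa> where "\<kappa> x = k (snd x $ 1) + fst x * bump a \<delta> (snd x)" for x
  have \<kappa>: "smooth_on ?S \<kappa>"
    unfolding \<kappa>_def[abs_def] by (rule smooth_on_add[OF S k smooth_on_mult[OF S t b]])
  have "(\<lambda>(t, p). bump_variation a \<delta> t p) = (\<lambda>x. sin (\<kappa> x) *\<^sub>R (pole, 0)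
      + ((cos (\<kappa> x) * cos (snd x $ 2)) *\<^sub>R (axis 2 1, 0)
      + ((cos (\<kappa> x) * sin (snd x $ 2)) *\<^sub>R (axis 3 1, 0) + h (snd x $ 1) *\<^sub>R (0, 1))))"
    by (simp add: fun_eq_iff bump_variation_def \<kappa>_def radial_def scaleR_add_right)
  moreover have "smooth_on ?S \<dots>"
    by (rule smooth_on_add[OF S smooth_on_scaleR[OF S smooth_on_sin[OF S \<kappa>] smooth_on_const]
        smooth_on_add[OF S smooth_on_scaleR[OF S smooth_on_mult[OF S smooth_on_cos[OF S \<kappa>] smooth_on_cos[OF S c]] smooth_on_const]
        smooth_on_add[OF S smooth_on_scaleR[OF S smooth_on_mult[OF S smooth_on_cos[OF S \<kappa>] smooth_on_sin[OF S c]] smooth_on_const]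
          smooth_on_scaleR[OF S h smooth_on_const]]]])
  ultimately show ?thesis by simp
qed

lemma bump_variation_of:
  assumes "0 < \<delta>"
  shows "variation_of D (cball a \<delta>) \<phi> 1 (bump_variation a \<delta>)"
proof -
  have "norm (sin x *\<^sub>R pole + cos x *\<^sub>R radial y) = 1" for x y
    by (simp add: norm_eq_1 inner_add_left inner_add_right power2_eq_square[symmetric])
  then have "bump_variation a \<delta> t p \<in> S2xR" for t p
    by (simp add: bump_variation_def S2xR_def)
  moreover have "bump_variation a \<delta> 0 p = \<phi> p" for p
    by (simp add: bump_variation_def rotation_surface_eq sphere_part_def)
  moreover have "bump_variation a \<delta> t p = \<phi> p" if "p \<in> D - cball a \<delta>" for t p
  proof -
    have "bump a \<delta> p = 0" using that assms by (intro bump_zero) auto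
    then show ?thesis by (simp add: bump_variation_def rotation_surface_eq sphere_part_def)
  qed
  ultimately show ?thesis
    using smooth_bump_variation by (simp add: variation_of_def)
qed

lemma bump_variation_field:
  assumes p: "p \<in> D"
  shows "dir_deriv (1, 0) (\<lambda>(t, p). bump_variation a \<delta> t p) (0, p) = (bump a \<delta> p *\<^sub>R meridian p, 0)"
proof -
  have "((\<lambda>t. bump_variation a \<delta> t p) has_derivative (\<lambda>d. d *\<^sub>R (bump a \<delta> p *\<^sub>R meridian p, 0))) (at 0)"
    unfolding bump_variation_def
    by (auto intro!: derivative_eq_intros simp: meridian_def algebra_simps)
  from has_derivative_unique[OF this time_has_derivative[OF smooth_bump_variation _ p, of 0, simplified]]
  have "(\<lambda>d. d *\<^sub>R (bump a \<delta> p *\<^sub>R meridian p, 0::real)) =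
      (\<lambda>d. d *\<^sub>R dir_deriv (1, 0) (\<lambda>(t, p). bump_variation a \<delta> t p) (0, p))" .
  from fun_cong[OF this, of 1] show ?thesis by simp
qed

text \<open>The test field is \<open>N\<close> times a bump function supported where \<open>\<rho>\<close> keeps its sign.\<close>

lemma biharmonic_imp_\<rho>_zero:
  assumes bi: "biharmonic_surface D \<phi>" and r: "r \<in> I"
  shows "\<rho> r = 0"
proof (rule ccontr)
  assume nz: "\<rho> r \<noteq> 0"
  obtain a where a: "a \<in> D" "r = a $ 1" using r by auto
  have "continuous_on I \<rho>"
    unfolding \<rho>_def[abs_def]
    by (intro continuous_intros continuous_coefficients) (use E_pos in force)
  then have cont: "continuous_on D (\<lambda>p. \<rho> (p $ 1) * \<rho> r)"
    by (intro continuous_on_mult continuous_on_const continuous_on_of_r)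
  have "open {p \<in> D. 0 < \<rho> (p $ 1) * \<rho> r}"
    using continuous_open_preimage[OF cont open_D open_greaterThan[of 0]]
    by (simp add: vimage_def Int_def)
  moreover have "a \<in> {p \<in> D. 0 < \<rho> (p $ 1) * \<rho> r}"
    using nz a by (simp add: zero_less_mult_iff) linarith
  ultimately obtain \<delta> where \<delta>: "0 < \<delta>" "cball a \<delta> \<subseteq> {p \<in> D. 0 < \<rho> (p $ 1) * \<rho> r}"
    using open_contains_cball by blast
  let ?K = "cball a \<delta>" and ?F = "bump_variation a \<delta>"
  define V where "V = (\<lambda>p. dir_deriv (1, 0) (\<lambda>(t, p). ?F t p) (0, p))"
  have K: "compact ?K" "?K \<subseteq> D" using \<delta>(2) by auto
  have var: "variation_of D ?K \<phi> 1 ?F" by (rule bump_variation_of[OF \<delta>(1)])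
  have Vp: "V p = (bump a \<delta> p *\<^sub>R meridian p, 0)" if "p \<in> D" for p
    unfolding V_def by (rule bump_variation_field[OF that])
  have V: "smooth_on D V" unfolding V_def by (rule variation_field(1)[OF K _ var]) simp
  have snd1: "snd (partial_deriv i V p) = 0" if "p \<in> D" for i p
    by (rule snd_partial_deriv_zero[OF V _ that]) (simp add: Vp)
  have snd2: "snd (partial_deriv j (partial_deriv i V) p) = 0" if "p \<in> D" for i j p
    by (rule snd_partial_deriv_zero[OF smooth_on_partial_deriv[OF V] snd1 that])
  have lapV: "snd (lap V p) = 0" if "p \<in> D" for p
    by (simp add: lap_def snd1[OF that] snd2[OF that])
  define f where "f p = \<sigma> (p $ 1) * (\<rho> (p $ 1) * bump a \<delta> p)" for p
  have crit: "((\<lambda>t. bienergy g ?K (?F t)) has_real_derivative 0) (at 0)"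
    using bi K var zero_less_one unfolding biharmonic_surface_def biharmonic_map_def by blast
  have zero: "(LINT p:?K|lborel. \<sigma> (p $ 1) *
      (\<rho> (p $ 1) * (fst (V p) \<bullet> meridian p) + height_tension (p $ 1) * snd (lap V p))) = 0"
    unfolding V_def by (rule DERIV_unique[OF first_variation[OF K zero_less_one var] crit])
  have integrand: "indicator ?K p *\<^sub>R (\<sigma> (p $ 1) * (\<rho> (p $ 1) * (fst (V p) \<bullet> meridian p) + height_tension (p $ 1) * snd (lap V p)))
      = indicator ?K p *\<^sub>R f p" for p
    using K(2) by (cases "p \<in> ?K") (auto simp: Vp lapV f_def)
  have "(LINT p:?K|lborel. f p) = 0"
    using zero unfolding set_lebesgue_integral_def integrand .
  (* the constant factor \<rho> r makes the integrand nonnegative *)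
  then have "(LINT p:?K|lborel. \<rho> r * f p) = 0" by simp
  moreover have "(LINT p:?K|lborel. \<rho> r * f p) \<noteq> 0"
  proof (rule set_integral_pos_of_continuous[OF K(1), of _ "ball a \<delta>"])
    have cb: "continuous_on D (bump a \<delta>)"
    proof -
      have "isCont (flat_exp 1) x" for x by (rule DERIV_isCont[OF flat_exp_has_derivative])
      then have "continuous_on UNIV (flat_exp 1)" by (simp add: continuous_at_imp_continuous_on)
      then show ?thesis
        unfolding bump_def[abs_def]
        by (rule continuous_on_compose2) (auto intro!: continuous_on_diff continuous_on_add continuous_on_mult
            continuous_on_component continuous_on_const)
    qed
    show "continuous_on ?K (\<lambda>p. \<rho> r * f p)"
      unfolding f_def
      by (rule continuous_on_subset[OF _ K(2)])
         (intro continuous_on_mult continuous_on_const continuous_on_of_r continuous_coefficients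
           \<open>continuous_on I \<rho>\<close> cb)
    show "0 < \<rho> r * f p" if "p \<in> ball a \<delta>" for p
    proof -
      have "p \<in> cball a \<delta>" using that by simp
      then have p: "p \<in> D" "0 < \<rho> (p $ 1) * \<rho> r" using \<delta>(2) by blast+
      have "0 < (\<rho> (p $ 1) * \<rho> r) * (\<sigma> (p $ 1) * bump a \<delta> p)"
        using p \<sigma>_pos[of "p $ 1"] bump_pos[OF that] by simp
      then show ?thesis by (simp add: f_def mult_ac)
    qed
    then show "0 \<le> \<rho> r * f p" if "p \<in> ?K" for p
      using bump_zero[of p a \<delta>] \<delta>(1) by (cases "p \<in> ball a \<delta>") (auto simp: f_def less_imp_le)
  qed (use \<delta> in auto)
  ultimately show False by simp
qed

lemma mean_curvature_eq:
  assumes p: "p \<in> D" and \<xi>: "unit_normal \<phi> p \<xi>"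
  shows "tension_field g \<phi> p \<bullet> \<xi> = 2 * mean_curvature \<phi> \<xi> p"
  using \<xi> by (simp add: tension_field_def mean_curvature_def metric_trace_eq[OF p] nabla_d_def
      second_fundamental_form_def unit_normal_def inner_add_left inner_diff_left sum_2 inner_commute[of \<xi>])
    (simp add: algebra_simps)

lemma tan_k_zero_imp_constant:
  assumes w: "\<forall>r\<in>I. tan_k r = 0" and r: "r \<in> I" shows "k1 r = 0"
proof -
  have "(tan_k has_real_derivative 0) (at r)"
    by (rule has_field_derivative_transform_within_open[OF DERIV_const[of 0] open_I r]) (use w in auto)
  from DERIV_unique[OF this tan_k_deriv[OF r]] w r show ?thesis by simp
qed

text \<open>The tension field is normal, so where it does not vanish its normalisation is a unit normal with nonzero mean
  curvature. If \<open>tan k\<close> vanishes identically, \<open>k\<close> is constant and the other component of the tension field vanishes as well.\<close>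

lemma minimal_iff: "minimal_surface D \<phi> \<longleftrightarrow> (\<forall>r\<in>I. tan_k r = 0)"
proof
  assume min: "minimal_surface D \<phi>"
  show "\<forall>r\<in>I. tan_k r = 0"
  proof (rule ballI, rule ccontr)
    fix r assume r: "r \<in> I" and nz: "tan_k r \<noteq> 0"
    obtain p where p: "p \<in> D" "r = p $ 1" using r by auto
    define \<tau> where "\<tau> = tension_field g \<phi> p"
    have \<tau>: "\<tau> = (tan_k r *\<^sub>R meridian p, height_tension r)" by (simp add: \<tau>_def tension_rotation_surface[OF p(1)] p(2))
    have "meridian p \<noteq> 0" using inner_meridian(2)[of p] by (metis inner_zero_left zero_neq_one)
    then have "\<tau> \<noteq> 0" using nz by (simp add: \<tau> zero_prod_def)
    define \<xi> where "\<xi> = (1 / norm \<tau>) *\<^sub>R \<tau>"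
    have normal: "\<tau> \<bullet> partial_deriv i \<phi> p = 0" for i
      using exhaust_2[of i] tension_normal[OF r] p(2)
      by (auto simp: \<tau> partial_rotation_surface[OF p(1)] algebra_simps)
    have un: "unit_normal \<phi> p \<xi>"
      using \<open>\<tau> \<noteq> 0\<close> normal
      by (simp add: unit_normal_def \<xi>_def tangent_space_def rotation_surface_eq) (simp add: \<tau>)
    then have "mean_curvature \<phi> \<xi> p = 0"
      using min p(1) unfolding minimal_surface_def by blast
    then have "\<tau> \<bullet> \<xi> = 0"
      using mean_curvature_eq[OF p(1) un] by (simp add: \<tau>_def)
    then show False using \<open>\<tau> \<noteq> 0\<close> by (simp add: \<xi>_def)
  qed
next
  assume w: "\<forall>r\<in>I. tan_k r = 0"
  note k1 = tan_k_zero_imp_constant[OF w]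
  have "tension_field g \<phi> p = 0" if p: "p \<in> D" for p
    using tension_rotation_surface[OF p] w in_I[OF p] constant_imp_height_tension_zero[OF in_I[OF p] k1[OF in_I[OF p]]]
    by (simp add: zero_prod_def)
  then show "minimal_surface D \<phi>"
    unfolding minimal_surface_def using mean_curvature_eq by force
qed

end

section \<open>Vertical cylinders\<close>

lemma frame_expansion:
  "x = (x \<bullet> pole) *\<^sub>R pole + (x \<bullet> radial \<theta>) *\<^sub>R radial \<theta> + (x \<bullet> angular \<theta>) *\<^sub>R angular \<theta>"
proof -
  have inner: "x \<bullet> pole = x $ 1" "x \<bullet> radial \<theta> = cos \<theta> * x $ 2 + sin \<theta> * x $ 3"
    "x \<bullet> angular \<theta> = cos \<theta> * x $ 3 - sin \<theta> * x $ 2"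
    by (simp_all add: pole_def radial_def angular_def inner_vec_def sum_3 axis_def)
  have c: "cos \<theta> * cos \<theta> = 1 - sin \<theta> * sin \<theta>"
    using sin_cos_squared_add[of \<theta>] by (simp add: power2_eq_square)
  have "x $ 2 = (cos \<theta> * x $ 2 + sin \<theta> * x $ 3) * cos \<theta> - (cos \<theta> * x $ 3 - sin \<theta> * x $ 2) * sin \<theta>"
    "x $ 3 = (cos \<theta> * x $ 2 + sin \<theta> * x $ 3) * sin \<theta> + (cos \<theta> * x $ 3 - sin \<theta> * x $ 2) * cos \<theta>"
    using c by (algebra, algebra)
  then show ?thesis
    unfolding inner by (simp add: vec_eq_iff forall_3 pole_def radial_def angular_def axis_def)
qed

lemma radial_add: "radial (\<theta> + \<alpha>) = cos \<alpha> *\<^sub>R radial \<theta> + sin \<alpha> *\<^sub>R angular \<theta>"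
  by (simp add: radial_def angular_def cos_add sin_add algebra_simps)

lemma inner_self_frame: "x \<bullet> x = (x \<bullet> pole)\<^sup>2 + (x \<bullet> radial \<theta>)\<^sup>2 + (x \<bullet> angular \<theta>)\<^sup>2"
proof -
  have "x \<bullet> x = x \<bullet> ((x \<bullet> pole) *\<^sub>R pole + (x \<bullet> radial \<theta>) *\<^sub>R radial \<theta> + (x \<bullet> angular \<theta>) *\<^sub>R angular \<theta>)"
    using frame_expansion[of x \<theta>] by simp
  then show ?thesis by (simp add: inner_add_right power2_eq_square)
qed

context harmonic_rotation_patch
begin

text \<open>Two derivatives along a parallel: a linear function that is constant on the surface has its gradient on the axis of rotation.\<close>

lemma inner_constant_imp:
  assumes a: "\<And>p. p \<in> D \<Longrightarrow> a \<bullet> sphere_part p = s" and p: "p \<in> D"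
  shows "a \<bullet> angular (p $ 2) = 0" "a \<bullet> radial (p $ 2) = 0"
proof -
  have 1: "a \<bullet> angular (q $ 2) = 0" if q: "q \<in> D" for q
  proof -
    have "partial_deriv 2 (\<lambda>p. a \<bullet> sphere_part p) q = partial_deriv 2 (\<lambda>_. s) q"
      by (rule partial_deriv_cong[OF open_D q a])
    moreover have "partial_deriv 2 (\<lambda>p. a \<bullet> sphere_part p) q = cos (k (q $ 1)) * (a \<bullet> angular (q $ 2))"
      using partial_derivI[OF has_derivative_inner_right[OF sphere_part_has_derivative[OF q]], of 2 a]
      by (simp add: axis_def)
    ultimately show ?thesis using cos_k_nonzero[OF in_I[OF q]] by (simp add: partial_deriv_const)
  qed
  show "a \<bullet> angular (p $ 2) = 0" by (rule 1[OF p])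
  have "partial_deriv 2 (\<lambda>p. a \<bullet> angular (p $ 2)) p = partial_deriv 2 (\<lambda>_. 0) p"
    by (rule partial_deriv_cong[OF open_D p 1])
  moreover have "partial_deriv 2 (\<lambda>p. a \<bullet> angular (p $ 2)) p = - (a \<bullet> radial (p $ 2))"
    using partial_derivI[OF has_derivative_inner_right[OF angular_has_derivative], of 2 a p]
    by (simp add: axis_def)
  ultimately show "a \<bullet> radial (p $ 2) = 0" by (simp add: partial_deriv_const)
qed

text \<open>The circle contains an arc of each parallel of the surface, which forces its plane to be orthogonal to the axis of rotation and its
  centre onto the axis. Then \<open>sin k\<close> is the height of the centre, and the radius determines its square.\<close>

lemma cylinder_imp_constant:
  assumes cyl: "open_part_of_vertical_cylinder (1 / sqrt 2) D \<phi>" and r: "r \<in> I"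
  shows "k1 r = 0" and "(tan_k r)\<^sup>2 = 1"
proof -
  obtain c n where n: "n \<noteq> 0" and sub: "\<phi> ` D \<subseteq> circle3 c n (1 / sqrt 2) \<times> UNIV"
    using cyl openin_imp_subset unfolding open_part_of_vertical_cylinder_def by metis
  have X: "dist (sphere_part p) c = 1 / sqrt 2" "n \<bullet> (sphere_part p - c) = 0" if "p \<in> D" for p
    using sub that by (force simp: circle3_def rotation_surface_eq image_subset_iff)+
  (* expand |X - c|^2 = 1/2 with |X| = 1 *)
  have cX: "c \<bullet> sphere_part p = (1 + c \<bullet> c - 1 / 2) / 2" if p: "p \<in> D" for p
  proof -
    have "(dist (sphere_part p) c)\<^sup>2 = 1 - 2 * (c \<bullet> sphere_part p) + c \<bullet> c"
      by (simp add: dist_norm power2_norm_eq_inner inner_diff_left inner_diff_right inner_commute[of "sphere_part p" c])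
    then show ?thesis unfolding X(1)[OF p] by (simp add: power_divide)
  qed
  have nX: "n \<bullet> sphere_part p = n \<bullet> c" if "p \<in> D" for p
    using X(2)[OF that] by (simp add: inner_diff_right)
  have pole: "a = (a \<bullet> pole) *\<^sub>R pole"
    if "\<And>p. p \<in> D \<Longrightarrow> a \<bullet> sphere_part p = s" "p \<in> D" for a s p
    using frame_expansion[of a "p $ 2"] inner_constant_imp[OF that] by simp
  have sin: "sin (k s) = c \<bullet> pole" if s: "s \<in> I" for s
  proof -
    obtain p where p: "p \<in> D" "s = p $ 1" using s by auto
    have n': "n = (n \<bullet> pole) *\<^sub>R pole" by (rule pole[OF nX p(1)])
    then have "n \<bullet> pole \<noteq> 0" using n by auto
    moreover have "(n \<bullet> pole) * sin (k s) = (n \<bullet> pole) * (c \<bullet> pole)"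
    proof -
      have "pole \<bullet> sphere_part p = sin (k s)" by (simp add: sphere_part_def inner_add_right p(2))
      moreover have "n \<bullet> sphere_part p = (n \<bullet> pole) * (pole \<bullet> sphere_part p)" by (subst n') simp
      moreover have "n \<bullet> c = (n \<bullet> pole) * (pole \<bullet> c)" by (subst n') simp
      ultimately show ?thesis
        using nX[OF p(1)] by (metis inner_commute)
    qed
    ultimately show ?thesis by simp
  qed
  have "((\<lambda>s. sin (k s)) has_real_derivative cos (k r) * k1 r) (at r)"
    by (rule DERIV_chain2[OF DERIV_sin k_deriv[OF r]])
  moreover have "((\<lambda>s. sin (k s)) has_real_derivative 0) (at r)"
    by (rule has_field_derivative_transform_within_open[OF DERIV_const open_I r]) (simp add: sin)
  ultimately have "cos (k r) * k1 r = 0" by (rule DERIV_unique)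
  then show "k1 r = 0" using cos_k_nonzero[OF r] by simp
  obtain p where p: "p \<in> D" "r = p $ 1" using r by auto
  have c': "c = sin (k r) *\<^sub>R pole" using pole[OF cX p(1)] sin[OF r] by simp
  have "c \<bullet> sphere_part p = (sin (k r))\<^sup>2" "c \<bullet> c = (sin (k r))\<^sup>2"
    unfolding c' by (simp_all add: sphere_part_def inner_add_right p(2) power2_eq_square)
  with cX[OF p(1)] have "(sin (k r))\<^sup>2 = 1 / 2" by simp
  moreover from this have "(cos (k r))\<^sup>2 = 1 / 2" by (simp add: cos_squared_eq)
  ultimately show "(tan_k r)\<^sup>2 = 1"
    using cos_k_nonzero[OF r] by (simp add: tan_k_def tan_def power_divide)
qed

text \<open>For constant \<open>k\<close> the surface is \<open>(r, \<theta>) \<mapsto> (point of the circle at angle \<theta>, h r)\<close>. Locally \<open>h\<close> is injective with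
  open image because \<open>h' \<noteq> 0\<close>, and \<open>\<theta>\<close> is recovered by the arcsine; so the image is open in the cylinder.\<close>

lemma constant_imp_cylinder:
  assumes k1: "\<And>r. r \<in> I \<Longrightarrow> k1 r = 0" and w: "\<And>r. r \<in> I \<Longrightarrow> (tan_k r)\<^sup>2 = 1" and ne: "D \<noteq> {}"
  shows "open_part_of_vertical_cylinder (1 / sqrt 2) D \<phi>"
proof -
  have "k constant_on I"
    by (rule has_field_derivative_0_imp_constant_on[OF _ connected_I open_I]) (use k_deriv k1 in force)
  then obtain k0 where k0: "\<And>r. r \<in> I \<Longrightarrow> k r = k0" unfolding constant_on_def by blast
  have half: "(cos k0)\<^sup>2 = 1 / 2" "(sin k0)\<^sup>2 = 1 / 2"
  proof -
    obtain s where s: "s \<in> I" using ne by blast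
    have "(sin k0)\<^sup>2 = (cos k0)\<^sup>2"
      using sin_k_eq[OF s] w[OF s] k0[OF s] by (simp add: power_mult_distrib)
    then show "(cos k0)\<^sup>2 = 1 / 2" "(sin k0)\<^sup>2 = 1 / 2" using sin_cos_squared_add[of k0] by auto
  qed
  then have cos0: "cos k0 \<noteq> 0" by auto
  define c where "c = sin k0 *\<^sub>R pole"
  define C where "C = circle3 c pole (1 / sqrt 2)"
  have C: "x \<in> C \<longleftrightarrow> x \<bullet> pole = sin k0 \<and> (x \<bullet> radial \<theta>)\<^sup>2 + (x \<bullet> angular \<theta>)\<^sup>2 = 1 / 2" for x \<theta>
  proof -
    have "(x - c) \<bullet> (x - c) = (x \<bullet> pole - sin k0)\<^sup>2 + ((x \<bullet> radial \<theta>)\<^sup>2 + (x \<bullet> angular \<theta>)\<^sup>2)"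
      by (subst inner_self_frame[of _ \<theta>]) (simp add: c_def inner_diff_left)
    moreover have "dist x c = 1 / sqrt 2 \<longleftrightarrow> (x - c) \<bullet> (x - c) = 1 / 2"
    proof -
      have "1 / sqrt 2 = sqrt (1 / 2)" by (simp add: real_sqrt_divide)
      then show ?thesis by (simp only: dist_norm norm_eq_sqrt_inner real_sqrt_eq_iff)
    qed
    moreover have "pole \<bullet> (x - c) = 0 \<longleftrightarrow> x \<bullet> pole = sin k0"
      by (simp add: c_def inner_diff_right inner_commute)
    ultimately show ?thesis by (auto simp: C_def circle3_def)
  qed
  have Csphere: "C \<subseteq> sphere 0 1"
  proof
    fix x assume "x \<in> C"
    then have "x \<bullet> x = 1" using C[of x 0] inner_self_frame[of x 0] half by simp
    then show "x \<in> sphere 0 1" by (simp add: norm_eq_1)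
  qed
  have \<phi>: "\<phi> p = (sin k0 *\<^sub>R pole + cos k0 *\<^sub>R radial (p $ 2), h (p $ 1))" if "p \<in> D" for p
    using k0[OF in_I[OF that]] by (simp add: rotation_surface_eq sphere_part_def)
  have "openin (top_of_set (C \<times> UNIV)) (\<phi> ` D)"
  proof (subst openin_subopen, rule ballI)
    fix y assume "y \<in> \<phi> ` D"
    then obtain p0 where p0: "p0 \<in> D" "y = \<phi> p0" by blast
    define \<theta> where "\<theta> = p0 $ 2"
    obtain e where e: "0 < e" "ball p0 e \<subseteq> D" using open_D p0(1) openE by blast
    (* 1 is a bound below pi / 2, where the arcsine inverts the sine *)
    define \<delta> where "\<delta> = min (e / 2) 1"
    have \<delta>: "0 < \<delta>" "\<delta> \<le> e / 2" "\<delta> \<le> pi / 2" using e pi_half_gt_zero pi_ge_two by (auto simp: \<delta>_def)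
    have box: "p \<in> D" if "\<bar>p $ 1 - p0 $ 1\<bar> < \<delta>" "\<bar>p $ 2 - \<theta>\<bar> < \<delta>" for p
    proof -
      have "norm (p - p0) \<le> (\<Sum>i\<in>UNIV. \<bar>(p - p0) $ i\<bar>)" by (rule norm_le_l1_cart)
      also have "\<dots> < e" using that \<delta>(2) by (simp add: sum_2 \<theta>_def)
      finally have "p \<in> ball p0 e" by (simp add: dist_norm norm_minus_commute)
      then show ?thesis using e by blast
    qed
    define R where "R = {p0 $ 1 - \<delta><..<p0 $ 1 + \<delta>}"
    have R: "r \<in> I" if "r \<in> R" for r
    proof -
      have "vector [r, \<theta>] \<in> D" using that \<delta> by (intro box) (auto simp: R_def)
      from in_I[OF this] show ?thesis by simp
    qed
    have "inj_on h R"
    proof (rule inj_on_of_nonzero_derivative)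
      show "(h has_real_derivative h1 r) (at r)" if "r \<in> R" for r by (rule h_deriv[OF R[OF that]])
      show "h1 r \<noteq> 0" if "r \<in> R" for r
        using E_pos[OF R[OF that]] k1[OF R[OF that]] by (auto simp: E_def)
    qed (simp add: R_def)
    moreover have "continuous_on R h"
      by (rule continuous_at_imp_continuous_on) (use h_deriv R DERIV_isCont in blast)
    ultimately have "open (h ` R)"
      using injective_eq_1d_open_map_UNIV[of R h] by (simp add: R_def is_interval_oo)
    (* the points of the cylinder in W are those at an angle within \<delta> of \<theta>, at a height taken on R;
       the factor cos k0 in the first condition selects the half circle around the angle \<theta> for either sign *)
    define W :: "ambient set" where "W = {y. 0 < cos k0 * (fst y \<bullet> radial \<theta>)} \<inter>
      {y. \<bar>fst y \<bullet> angular \<theta>\<bar> < \<bar>cos k0\<bar> * sin \<delta>} \<inter> (UNIV \<times> h ` R)"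
    have "open W"
      unfolding W_def
      by (intro open_Int open_Times open_Collect_less continuous_intros open_UNIV \<open>open (h ` R)\<close>)
    then have "openin (top_of_set (C \<times> UNIV)) ((C \<times> UNIV) \<inter> W)" by (rule openin_open_Int)
    moreover have "y \<in> (C \<times> UNIV) \<inter> W"
    proof -
      have "0 < sin \<delta>" using \<delta> pi_gt_zero by (intro sin_gt_zero) linarith+
      then show ?thesis
        unfolding p0(2) \<phi>[OF p0(1)] W_def
        using C[of _ \<theta>] half cos0 \<delta>(1)
        by (auto simp: \<theta>_def R_def inner_add_left power2_eq_square)
    qed
    moreover have "(C \<times> UNIV) \<inter> W \<subseteq> \<phi> ` D"
    proof
      fix z assume z: "z \<in> (C \<times> UNIV) \<inter> W"
      then obtain r where r: "r \<in> R" "snd z = h r" by (auto simp: W_def)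
      define u v where "u = fst z \<bullet> radial \<theta>" and "v = fst z \<bullet> angular \<theta>"
      have uv: "u\<^sup>2 + v\<^sup>2 = 1 / 2" and zp: "fst z \<bullet> pole = sin k0"
        using z C[of "fst z" \<theta>] by (auto simp: u_def v_def mem_Times_iff)
      have u: "0 < u / cos k0" and v: "\<bar>v / cos k0\<bar> < sin \<delta>"
        using z cos0 by (auto simp: W_def u_def v_def abs_divide divide_less_eq mult.commute
            zero_less_divide_iff zero_less_mult_iff)
      define \<alpha> where "\<alpha> = arcsin (v / cos k0)"
      have v1: "-1 \<le> v / cos k0" "v / cos k0 \<le> 1" using v sin_le_one[of \<delta>] by linarith+
      have sin\<alpha>: "sin \<alpha> = v / cos k0" unfolding \<alpha>_def by (rule sin_arcsin[OF v1])
      have "cos \<alpha> = sqrt (1 - (v / cos k0)\<^sup>2)" unfolding \<alpha>_def by (rule cos_arcsin[OF v1])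
      also have "1 - (v / cos k0)\<^sup>2 = (u / cos k0)\<^sup>2"
        unfolding power_divide half(1) using uv by simp
      finally have cos\<alpha>: "cos \<alpha> = u / cos k0"
        using u by (simp only: real_sqrt_abs abs_of_pos)
      have "\<bar>\<alpha>\<bar> < \<delta>"
      proof -
        have vs: "v / cos k0 < sin \<delta>" "- sin \<delta> < v / cos k0" using v by linarith+
        have "arcsin (v / cos k0) < arcsin (sin \<delta>)"
          by (rule arcsin_less_arcsin[OF v1(1) vs(1) sin_le_one])
        moreover have "arcsin (- sin \<delta>) < arcsin (v / cos k0)"
          by (rule arcsin_less_arcsin[OF _ vs(2) v1(2)]) simp
        moreover have "arcsin (sin \<delta>) = \<delta>" using \<delta> by (intro arcsin_sin) auto
        moreover have "arcsin (- sin \<delta>) = - \<delta>"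
          using arcsin_sin[of "- \<delta>"] \<delta> by simp
        ultimately show ?thesis by (auto simp: \<alpha>_def)
      qed
      then have pD: "vector [r, \<theta> + \<alpha>] \<in> D" using r(1) by (intro box) (auto simp: R_def)
      have "fst z = sin k0 *\<^sub>R pole + (u *\<^sub>R radial \<theta> + v *\<^sub>R angular \<theta>)"
        using frame_expansion[of "fst z" \<theta>] zp by (simp add: u_def v_def add.assoc)
      also have "u *\<^sub>R radial \<theta> + v *\<^sub>R angular \<theta> = cos k0 *\<^sub>R radial (\<theta> + \<alpha>)"
        using cos0 by (simp add: radial_add sin\<alpha> cos\<alpha> scaleR_add_right)
      finally have "z = \<phi> (vector [r, \<theta> + \<alpha>])"
        unfolding \<phi>[OF pD] using r(2) by (simp add: prod_eq_iff)
      then show "z \<in> \<phi> ` D" using pD by blast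
    qed
    ultimately show "\<exists>T. openin (top_of_set (C \<times> UNIV)) T \<and> y \<in> T \<and> T \<subseteq> \<phi> ` D" by blast
  qed
  moreover have "pole \<noteq> 0" using inner_frame(1) by (metis inner_zero_left zero_neq_one)
  ultimately show ?thesis
    unfolding open_part_of_vertical_cylinder_def using Csphere unfolding C_def by blast
qed

lemma biharmonic_iff:
  "biharmonic_surface D \<phi> \<longleftrightarrow>
    minimal_surface D \<phi> \<or> open_part_of_vertical_cylinder (1 / sqrt 2) D \<phi>"
proof
  assume "biharmonic_surface D \<phi>"
  then have \<rho>: "\<rho> r = 0" if "r \<in> I" for r using biharmonic_imp_\<rho>_zero that by blast
  have k1: "k1 r = 0" and w: "tan_k r = 0 \<or> (tan_k r)\<^sup>2 = 1" if "r \<in> I" for r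
    using \<rho>_zero_imp_constant[OF \<rho> that] by auto
  have "tan_k constant_on I"
    by (rule has_field_derivative_0_imp_constant_on[OF _ connected_I open_I]) (use tan_k_deriv k1 in force)
  then obtain w0 where w0: "\<And>r. r \<in> I \<Longrightarrow> tan_k r = w0" unfolding constant_on_def by blast
  show "minimal_surface D \<phi> \<or> open_part_of_vertical_cylinder (1 / sqrt 2) D \<phi>"
  proof (cases "D = {} \<or> w0 = 0")
    case True
    then have "\<forall>r\<in>I. tan_k r = 0" using w0 by auto
    then show ?thesis by (simp add: minimal_iff)
  next
    case False
    have "(tan_k r)\<^sup>2 = 1" if "r \<in> I" for r using w[OF that] w0[OF that] False by auto
    then show ?thesis using constant_imp_cylinder[OF k1] False by blast
  qed
next
  assume "minimal_surface D \<phi> \<or> open_part_of_vertical_cylinder (1 / sqrt 2) D \<phi>"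
  then show "biharmonic_surface D \<phi>"
  proof
    assume "minimal_surface D \<phi>"
    then have w: "\<forall>r\<in>I. tan_k r = 0" by (simp add: minimal_iff)
    then show ?thesis using tan_k_zero_imp_constant by (intro constant_imp_biharmonic) auto
  next
    assume "open_part_of_vertical_cylinder (1 / sqrt 2) D \<phi>"
    then show ?thesis using cylinder_imp_constant by (intro constant_imp_biharmonic) auto
  qed
qed

end

theorem theorem5p3:
  fixes D :: "(real^2) set" and k h :: "real \<Rightarrow> real"
  assumes "open D" and "connected D"
    and "smooth_on ((\<lambda>p. p $ 1) ` D) k" and "smooth_on ((\<lambda>p. p $ 1) ` D) h"
    and "immersed_surface D (rotation_surface k h)"
    and "\<forall>p\<in>D. laplacian (induced_metric (rotation_surface k h)) (\<lambda>q. k (q $ 1)) p = 0"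
  shows "biharmonic_surface D (rotation_surface k h) \<longleftrightarrow>
    minimal_surface D (rotation_surface k h) \<or>
    open_part_of_vertical_cylinder (1 / sqrt 2) D (rotation_surface k h)"
proof -
  interpret harmonic_rotation_patch D k h
    using assms by unfold_locales
  show ?thesis by (rule biharmonic_iff)
qed

end
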